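(* Let $\mathbf{k}$ be a field of characteristic zero and $B$ a normal affine $\mathbf{k}$-domain. Consider a chain $A_0\subsetneq\cdots\subsetneq A_n$ ($n\ge 1$) of elements of $\mathcal{A}(B)$ satisfying $\operatorname{trdeg}(A_i:A_{i-1})=1$ for all $i\in\{1,\dots,n\}$. Assume that $$\operatorname{Frac}(A_n)\in\mathcal{K}(B)\quad\text{or}\quad\operatorname{Frac}(A_{n-1})\in\mathcal{K}(B).$$ Then $\operatorname{Frac}(A_{i-1})\in\mathcal{K}(B)$ and $A_{i-1}\in\mathcal{A}_1^*(A_i)$ for all $i\in\{1,\dots,n\}$, and in particular $$\operatorname{Frac} A_n=(\operatorname{Frac} A_0)^{(n)}.$$
   Context: All rings are commutative with unity; "domain" means integral domain. An affine $\mathbf{k}$-domain is a domain that is a finitely generated $\mathbf{k}$-algebra. A derivation $D:B\to B$ is locally nilpotent if for each $x\in B$ there is $n\in\mathbb{N}$ with $D^n(x)=0$; $\operatorname{LND}(B)$ is the set of locally nilpotent derivations $B\to B$. For a domain $B$ of characteristic zero and $\Delta\subseteq\operatorname{LND}(B)$, put $A_\Delta=\bigcap_{D\in\Delta}\ker D$ (intersection in $B$, $A_\emptyset=B$) and $K_\Delta=\bigcap_{D\in\Delta}\operatorname{Frac}(\ker D)$ (intersection in $\operatorname{Frac} B$, $K_\emptyset=\operatorname{Frac} B$). Put $\mathcal{A}(B)=\{A_\Delta:\Delta\subseteq\operatorname{LND}(B)\}$ and $\mathcal{K}(B)=\{K_\Delta:\Delta\subseteq\operatorname{LND}(B)\}$.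 For domains $R\subseteq A$, $\operatorname{trdeg}(A:R)$ is the transcendence degree of $\operatorname{Frac} A$ over $\operatorname{Frac} R$. For a domain $A$, $\mathcal{A}_1^*(A)$ is the set of subrings $R$ of $A$ such that $R$ is algebraically closed in $A$ and, with $S=R\setminus\{0\}$, $S^{-1}A$ is a polynomial ring in one variable over the field $S^{-1}R=\operatorname{Frac} R$. For fields, $L=K^{(n)}$ means that $L$ is a purely transcendental extension of $K$ of transcendence degree $n$. *)

theory Defs
  imports
    "HOL-Computational_Algebra.Polynomial_Factorial"
    "HOL-Library.Poly_Mapping"
begin

text \<open>
  The ambient domain \<open>B\<close> is a type \<open>'b :: idom\<close>, and \<open>Frac B\<close> is \<open>'b fract\<close>. Subrings of \<open>B\<close> are
  sets \<open>A :: 'b set\<close>; their localizations and fraction fields are taken inside \<open>'b fract\<close>, so that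
  all intersections and comparisons of fraction fields are those of subfields of \<open>Frac B\<close>.
\<close>

definition is_subring :: "'a::comm_ring_1 set \<Rightarrow> bool" where
  "is_subring R \<longleftrightarrow> 1 \<in> R \<and> (\<forall>x\<in>R. \<forall>y\<in>R. x - y \<in> R) \<and> (\<forall>x\<in>R. \<forall>y\<in>R. x * y \<in> R)"

definition is_subfield :: "'a::field set \<Rightarrow> bool" where
  "is_subfield K \<longleftrightarrow> is_subring K \<and> (\<forall>x\<in>K. inverse x \<in> K)"

definition algebraic_over :: "'a::idom set \<Rightarrow> 'a \<Rightarrow> bool" where
  "algebraic_over R x \<longleftrightarrow> (\<exists>p. p \<noteq> 0 \<and> (\<forall>i. coeff p i \<in> R) \<and> poly p x = 0)"

definition algebraically_closed_in :: "'a::idom set \<Rightarrow> 'a set \<Rightarrow> bool" where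
  "algebraically_closed_in R A \<longleftrightarrow> (\<forall>x\<in>A. algebraic_over R x \<longrightarrow> x \<in> R)"


subsection \<open>Localization and normality\<close>

definition localization :: "'b::idom set \<Rightarrow> 'b set \<Rightarrow> 'b fract set" where
  "localization S A = {Fract a s | a s. a \<in> A \<and> s \<in> S}"

definition frac_field :: "'b::idom set \<Rightarrow> 'b fract set" where
  "frac_field A = localization (A - {0}) A"

definition normal_domain :: "'b::idom set \<Rightarrow> bool" where
  "normal_domain A \<longleftrightarrow>
     (\<forall>x\<in>frac_field A.
        (\<exists>p. lead_coeff p = 1 \<and> (\<forall>i. coeff p i \<in> to_fract ` A) \<and> poly p x = 0)
          \<longrightarrow> x \<in> to_fract ` A)"


subsection \<open>Affine domains\<close>

definition is_ring_hom :: "('a::comm_ring_1 \<Rightarrow> 'b::comm_ring_1) \<Rightarrow> bool" where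
  "is_ring_hom \<phi> \<longleftrightarrow>
     \<phi> 1 = 1 \<and> (\<forall>x y. \<phi> (x + y) = \<phi> x + \<phi> y) \<and> (\<forall>x y. \<phi> (x * y) = \<phi> x * \<phi> y)"

text \<open>The domain \<open>'b\<close>, regarded as a \<open>'k\<close>-algebra via the structure map \<open>\<phi>\<close>, is affine.\<close>

definition affine_domain :: "('k::field \<Rightarrow> 'b::idom) \<Rightarrow> bool" where
  "affine_domain \<phi> \<longleftrightarrow>
     is_ring_hom \<phi> \<and> (\<exists>G. finite G \<and> is_subring hull (range \<phi> \<union> G) = UNIV)"


subsection \<open>Transcendence degree\<close>

text \<open>
  Polynomials over \<open>'a\<close> in variables indexed by the elements of \<open>'a\<close>; \<open>eval_at_self\<close> substitutes
  for every variable the element that indexes it. Thus \<open>X\<close> is algebraically independent over \<open>K\<close>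
  iff no nonzero polynomial over \<open>K\<close> in the variables \<open>X\<close> vanishes under this substitution.
\<close>

definition eval_at_self :: "(('a::comm_ring_1 \<Rightarrow>\<^sub>0 nat) \<Rightarrow>\<^sub>0 'a) \<Rightarrow> 'a" where
  "eval_at_self p =
     (\<Sum>m\<in>Poly_Mapping.keys p.
        Poly_Mapping.lookup p m * (\<Prod>x\<in>Poly_Mapping.keys m. x ^ Poly_Mapping.lookup m x))"

definition algebraically_independent :: "'a::field set \<Rightarrow> 'a set \<Rightarrow> bool" where
  "algebraically_independent K X \<longleftrightarrow>
     (\<forall>p. (\<forall>m. Poly_Mapping.lookup p m \<in> K) \<and>
          (\<forall>m\<in>Poly_Mapping.keys p. Poly_Mapping.keys m \<subseteq> X) \<and>
          eval_at_self p = 0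
        \<longrightarrow> p = 0)"

definition transcendence_basis :: "'a::field set \<Rightarrow> 'a set \<Rightarrow> 'a set \<Rightarrow> bool" where
  "transcendence_basis K L X \<longleftrightarrow>
     X \<subseteq> L \<and> algebraically_independent K X \<and>
     (\<forall>y\<in>L. algebraic_over (is_subfield hull (K \<union> X)) y)"

text \<open>
  \<open>trdeg_eq A R n\<close> means \<open>trdeg(A : R) = n\<close>, in particular that the degree is finite. It is stated
  as a relation because \<open>card\<close> does not distinguish infinite sets from the empty one.
\<close>

definition trdeg_eq :: "'b::idom set \<Rightarrow> 'b set \<Rightarrow> nat \<Rightarrow> bool" where
  "trdeg_eq A R n \<longleftrightarrow>
     (\<exists>X. transcendence_basis (frac_field R) (frac_field A) X \<and> finite X \<and> card X = n)"

text \<open>\<open>L = K\<^sup>(\<^sup>n\<^sup>)\<close>\<close>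

definition purely_transcendental :: "'a::field set \<Rightarrow> nat \<Rightarrow> 'a set \<Rightarrow> bool" where
  "purely_transcendental K n L \<longleftrightarrow>
     (\<exists>X. finite X \<and> card X = n \<and> algebraically_independent K X \<and>
          L = is_subfield hull (K \<union> X))"


subsection \<open>Polynomial rings in one variable\<close>

text \<open>
  \<open>P\<close> is a polynomial ring in one variable over its subring \<open>K\<close>: for some \<open>t\<close>, evaluation at \<open>t\<close>
  is a bijection (hence an isomorphism of \<open>K\<close>-algebras) from \<open>K[T]\<close> onto \<open>P\<close>.
\<close>

definition polynomial_ring_one_var :: "'a::comm_ring_1 set \<Rightarrow> 'a set \<Rightarrow> bool" where
  "polynomial_ring_one_var K P \<longleftrightarrow>
     (\<exists>t. bij_betw (\<lambda>p. poly p t) {p. \<forall>i. coeff p i \<in> K} P)"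

definition A1_star :: "'b::idom set \<Rightarrow> 'b set set" where
  "A1_star A =
     {R. is_subring R \<and> R \<subseteq> A \<and> algebraically_closed_in R A \<and>
         polynomial_ring_one_var (frac_field R) (localization (R - {0}) A)}"


subsection \<open>Locally nilpotent derivations\<close>

definition derivation :: "('b::comm_ring_1 \<Rightarrow> 'b) \<Rightarrow> bool" where
  "derivation D \<longleftrightarrow>
     (\<forall>x y. D (x + y) = D x + D y) \<and> (\<forall>x y. D (x * y) = D x * y + x * D y)"

definition LND :: "('b::comm_ring_1 \<Rightarrow> 'b) set" where
  "LND = {D. derivation D \<and> (\<forall>x. \<exists>n. (D ^^ n) x = 0)}"

definition ker :: "('b::zero \<Rightarrow> 'b) \<Rightarrow> 'b set" where
  "ker D = {x. D x = 0}"

definition A_of :: "('b::idom \<Rightarrow> 'b) set \<Rightarrow> 'b set" where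
  "A_of \<Delta> = (\<Inter>D\<in>\<Delta>. ker D)"

definition K_of :: "('b::idom \<Rightarrow> 'b) set \<Rightarrow> 'b fract set" where
  "K_of \<Delta> = (\<Inter>D\<in>\<Delta>. frac_field (ker D))"

definition A_sets :: "'b::idom set set" where
  "A_sets = {A_of \<Delta> | \<Delta>. \<Delta> \<subseteq> LND}"

definition K_sets :: "'b::idom fract set set" where
  "K_sets = {K_of \<Delta> | \<Delta>. \<Delta> \<subseteq> LND}"

end

theory Submission
  imports
    Defs
    "HOL-Computational_Algebra.Field_as_Ring"
    "HOL-Computational_Algebra.Polynomial_FPS"
begin

text \<open>
  Let \<open>E = Frac B\<close>. A locally nilpotent derivation \<open>D\<close> of \<open>B\<close> extends to \<open>E\<close>, and \<open>Frac (ker D)\<close> is the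
  kernel of the extension. Thus \<open>K_of \<Delta>\<close> is the field of common constants of \<open>\<Delta>\<close> in \<open>E\<close>
  (\<open>K_of_eq\<close>), and everything below is an argument about derivations and their constants.
  Transcendence degree one enters only as follows: a derivation that vanishes on \<open>Frac R\<close> and on one
  element of \<open>Frac A\<close> transcendental over \<open>Frac R\<close> vanishes on all of \<open>Frac A\<close>
  (\<open>derivation_vanishes_in_trdeg_1\<close>).

  \<^emph>\<open>Going down the chain.\<close> Let \<open>R \<subset> A\<close> be consecutive members, \<open>R = A_of \<Gamma>\<close> and \<open>Frac A = K_of \<Delta>\<close>.
  Normality of \<open>B\<close> makes \<open>Frac R\<close> algebraically closed in \<open>E\<close>. If some \<open>x\<close> in \<open>K_of (\<Delta> \<union> \<Gamma>)\<close> were not in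
  \<open>Frac R\<close>, it would be a transcendental element of \<open>Frac A\<close> killed by \<open>\<Gamma>\<close>, so \<open>\<Gamma>\<close> would kill \<open>A\<close>,
  and \<open>A = R\<close>. Hence \<open>Frac R = K_of (\<Delta> \<union> \<Gamma>)\<close> (\<open>frac_in_K_sets_descends\<close>).

  \<^emph>\<open>The polynomial ring.\<close> Now let \<open>K = Frac R = K_of \<Delta>\<close> and let \<open>P\<close> be the localization of \<open>A\<close> at
  \<open>R - {0}\<close>. Some \<open>D\<^sub>0 \<in> \<Delta>\<close> does not vanish on \<open>A\<close>, and \<open>exp (T D\<^sub>0)\<close> embeds \<open>P\<close> into \<open>E[T]\<close>, fixing \<open>K\<close>.
  The field \<open>E\<close> is much too large, but \<open>K\<close> is the field of constants of \<open>\<Delta>\<close> acting on \<open>E\<close>, and this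
  action gives the descent from \<open>E\<close> to \<open>K\<close>. Write \<open>f\<^sup>D\<close> for \<open>D\<close> applied to the coefficients of \<open>f\<close>, and
  fix a nonconstant \<open>t\<close> in the image of \<open>P\<close>. The derivation \<open>f \<mapsto> t' f\<^sup>D - t\<^sup>D f'\<close> kills \<open>K\<close> and \<open>t\<close>, hence the
  image of \<open>P\<close>. So this image is horizontal for \<open>\<nabla>\<^sub>D = D - w\<^sub>D d/dT\<close> with \<open>w\<^sub>D = t\<^sup>D/t'\<close>.

  \<^item> By a polynomial form of Lueroth's theorem (\<open>generated_by_one_polynomial\<close>) one may change the variable
    such that the \<open>E\<close>-span of the image of \<open>P\<close> has fraction field \<open>E(T)\<close>.
  \<^item> Then \<open>w\<^sub>D\<close> is a polynomial of degree at most one (\<open>polynomial_connection\<close>): at a pole \<open>\<pi>\<close> of order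
    \<open>r\<close>, the operator \<open>\<nabla>\<^sub>D\<close>, which preserves the span, would lower positive \<open>\<pi>\<close>-adic orders by exactly
    \<open>r + 1\<close>, so all orders on the span and on its fraction field would be multiples of \<open>r + 1\<close>.
  \<^item> A subspace of the span that is stable under all \<open>\<nabla>\<^sub>D\<close> contains vectors with coordinates in \<open>K\<close>, by an
    argument with vectors of minimal support (\<open>constant_coordinates\<close>). Applied to the multiples of \<open>1\<close> and
    \<open>T\<close>, it gives a horizontal polynomial \<open>u\<close> of degree one that is a quotient of elements of the image.

  A horizontal polynomial has coefficients in \<open>K\<close> when it is written in powers of \<open>u\<close>, so \<open>P \<subseteq> K[x]\<close> for
  some \<open>x \<in> Frac A\<close>. Then \<open>x\<close> is integral over \<open>P\<close>, normality gives \<open>x \<in> P\<close>, and \<open>P = K[x]\<close>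
  (\<open>A1_star_if_frac_in_K_sets\<close>). The generators of the steps of the chain together form the transcendence
  basis for \<open>Frac (A n)\<close>.
\<close>
section \<open>Ring homomorphisms and polynomials\<close>

context
  fixes \<phi> :: "'a::comm_ring_1 \<Rightarrow> 'b::comm_ring_1"
  assumes hom: "is_ring_hom \<phi>"
begin

lemma ring_hom_1: "\<phi> 1 = 1" and ring_hom_add: "\<phi> (x + y) = \<phi> x + \<phi> y"
  and ring_hom_mult: "\<phi> (x * y) = \<phi> x * \<phi> y"
  using hom by (auto simp: is_ring_hom_def)

lemma ring_hom_0: "\<phi> 0 = 0"
  using ring_hom_add[of 0 0] by simp

lemma ring_hom_uminus: "\<phi> (- x) = - \<phi> x"
  using ring_hom_add[of x "- x"] by (simp add: ring_hom_0 eq_neg_iff_add_eq_0 add.commute)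

lemma ring_hom_diff: "\<phi> (x - y) = \<phi> x - \<phi> y"
  using ring_hom_add[of x "- y"] by (simp add: ring_hom_uminus)

lemma ring_hom_sum: "\<phi> (sum f S) = (\<Sum>x\<in>S. \<phi> (f x))"
  by (induction S rule: infinite_finite_induct) (auto simp: ring_hom_0 ring_hom_add)

lemma ring_hom_of_nat: "\<phi> (of_nat n) = of_nat n"
  by (induction n) (auto simp: ring_hom_0 ring_hom_add ring_hom_1)

lemma is_ring_hom_map_poly: "is_ring_hom (map_poly \<phi>)"
  unfolding is_ring_hom_def
  by (auto intro!: poly_eqI
      simp: coeff_map_poly ring_hom_0 ring_hom_1 ring_hom_add ring_hom_mult ring_hom_sum coeff_mult)

lemma ring_hom_poly: "\<phi> (poly p x) = poly (map_poly \<phi> p) (\<phi> x)"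
  by (induction p) (auto simp: map_poly_pCons ring_hom_0 ring_hom_add ring_hom_mult)

end

lemma is_ring_hom_comp: "is_ring_hom f \<Longrightarrow> is_ring_hom g \<Longrightarrow> is_ring_hom (\<lambda>x. f (g x))"
  by (auto simp: is_ring_hom_def)

lemma is_ring_hom_const_poly: "is_ring_hom (\<lambda>a. [:a:])"
  by (auto simp: is_ring_hom_def one_pCons)

lemma is_ring_hom_poly: "is_ring_hom (\<lambda>p. poly p x)"
  by (auto simp: is_ring_hom_def)

section \<open>Subalgebras of a polynomial ring closed under exact division\<close>

definition swap_vars :: "'a::comm_ring_1 poly poly \<Rightarrow> 'a poly poly" where
  "swap_vars g = poly (map_poly (map_poly (\<lambda>a. [:a:])) g) [:[:0, 1:]:]"

lemma is_ring_hom_swap_vars: "is_ring_hom swap_vars"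
  unfolding swap_vars_def
  by (intro is_ring_hom_comp[OF is_ring_hom_poly] is_ring_hom_map_poly is_ring_hom_const_poly)

lemma coeff_swap_vars: "coeff (coeff (swap_vars g) k) i = coeff (coeff g i) k"
proof (induction g arbitrary: i)
  case 0
  then show ?case by (simp add: swap_vars_def)
next
  case (pCons c g)
  have "swap_vars (pCons c g) = map_poly (\<lambda>a. [:a:]) c + [:[:0, 1:]:] * swap_vars g"
    by (simp add: swap_vars_def map_poly_pCons)
  then show ?case
    by (cases i) (simp_all add: coeff_map_poly pCons.IH)
qed

lemma swap_vars_swap_vars: "swap_vars (swap_vars g) = g"
  by (auto intro!: poly_eqI simp: coeff_swap_vars)

lemma degree_swap_vars_le:
  assumes "\<And>i. degree (coeff g i) \<le> d"
  shows "degree (swap_vars g) \<le> d"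
proof (rule degree_le, intro allI impI)
  fix k assume "d < k"
  have "coeff (coeff g i) k = 0" for i
    using assms[of i] \<open>d < k\<close> by (intro coeff_eq_0) auto
  then show "coeff (swap_vars g) k = 0"
    by (intro poly_eqI) (simp add: coeff_swap_vars)
qed

text \<open>
  The polynomial \<open>f(X) - f(T)\<close>. Here and below \<open>T\<close> is the inner variable of the type \<open>'a poly poly\<close> and
  \<open>X\<close> the outer one.
\<close>

definition diff_poly :: "'a::comm_ring_1 poly \<Rightarrow> 'a poly poly" where
  "diff_poly f = map_poly (\<lambda>a. [:a:]) f - [:f:]"

lemma coeff_diff_poly: "coeff (diff_poly f) i = [:coeff f i:] - (if i = 0 then f else 0)"
  by (cases i) (auto simp: diff_poly_def coeff_map_poly)

lemma poly_diff_poly_var: "poly (diff_poly f) [:0, 1:] = 0"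
  by (simp add: diff_poly_def flip: pcompose_altdef)

lemma degree_diff_poly: "degree (diff_poly f) = degree f"
proof (cases "degree f = 0")
  case True
  then obtain a where "f = [:a:]" by (rule degree_eq_zeroE)
  then show ?thesis by (simp add: diff_poly_def map_poly_pCons)
next
  case False
  show ?thesis
  proof (rule antisym)
    show "degree (diff_poly f) \<le> degree f"
      by (rule degree_le) (auto simp: coeff_diff_poly coeff_eq_0)
    show "degree f \<le> degree (diff_poly f)"
      using False by (intro le_degree) (auto simp: coeff_diff_poly)
  qed
qed

text \<open>
  Such an \<open>N\<close> is the intersection of \<open>E[T]\<close> with the intermediate field \<open>Frac N\<close> of \<open>E(T)\<close>. Closure under
  exact division expresses this without leaving \<open>E[T]\<close>.
\<close>

locale exact_division_closed =
  fixes N :: "'e::field_gcd poly set"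
  assumes const_in: "[:a:] \<in> N"
    and diff_in: "f \<in> N \<Longrightarrow> g \<in> N \<Longrightarrow> f - g \<in> N"
    and mult_in: "f \<in> N \<Longrightarrow> g \<in> N \<Longrightarrow> f * g \<in> N"
    and quotient_in: "f \<in> N \<Longrightarrow> f \<noteq> 0 \<Longrightarrow> f * g \<in> N \<Longrightarrow> g \<in> N"
begin

lemma zero_in: "0 \<in> N" and one_in: "1 \<in> N"
  using const_in[of 0] const_in[of 1] by (simp_all add: one_pCons)

lemma add_in: "f \<in> N \<Longrightarrow> g \<in> N \<Longrightarrow> f + g \<in> N"
  using diff_in[of f "0 - g"] diff_in[of 0 g] zero_in by simp

definition polys_over :: "'e poly poly set" where
  "polys_over = {g. \<forall>i. coeff g i \<in> N}"

lemma coeff_diff_poly_in: "f \<in> N \<Longrightarrow> diff_poly f \<in> polys_over"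
  by (auto simp: polys_over_def coeff_diff_poly intro!: diff_in const_in zero_in)

text \<open>
  Pseudo-division by \<open>g\<close> only multiplies and subtracts coefficients, so it stays within the polynomials over
  \<open>N\<close>, and minimality of \<open>g\<close> forces the remainder to vanish.
\<close>

lemma dvd_multiple_of_minimal:
  assumes g: "g \<in> polys_over" "g \<noteq> 0"
    and min: "\<And>h. h \<in> polys_over \<Longrightarrow> h \<noteq> 0 \<Longrightarrow> poly h x = 0 \<Longrightarrow> degree g \<le> degree h"
    and gx: "poly g x = 0"
  shows "h \<in> polys_over \<Longrightarrow> poly h x = 0 \<Longrightarrow> \<exists>c. c \<noteq> 0 \<and> g dvd smult c h"
proof (induction "degree h" arbitrary: h rule: less_induct)
  case less
  show ?case
  proof (cases "h = 0")
    case True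
    then show ?thesis by (intro exI[of _ 1]) auto
  next
    case False
    then have le: "degree g \<le> degree h" using min less.prems by blast
    define q where "q = monom (lead_coeff h) (degree h - degree g) * g"
    define h1 where "h1 = smult (lead_coeff g) h - q"
    have h1: "h1 \<in> polys_over"
      using less.prems(1) g(1)
      by (auto simp: h1_def q_def polys_over_def coeff_monom_mult intro!: diff_in mult_in zero_in)
    have h1x: "poly h1 x = 0"
      using less.prems(2) gx by (simp add: h1_def q_def)
    have dq: "degree q = degree h"
      using le False g(2) unfolding q_def
      by (subst degree_mult_eq) (auto simp: degree_monom_eq monom_eq_0_iff)
    have lq: "coeff q (degree h) = lead_coeff h * lead_coeff g"
      using le by (simp add: q_def coeff_monom_mult)
    have eq: "smult (lead_coeff g) h = h1 + q" by (simp add: h1_def)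
    have "g dvd q" by (simp add: q_def)
    show ?thesis
    proof (cases "h1 = 0")
      case True
      with eq \<open>g dvd q\<close> g(2) show ?thesis
        by (intro exI[of _ "lead_coeff g"]) auto
    next
      case nz: False
      have "degree h1 \<le> degree h"
        unfolding h1_def using dq by (intro degree_diff_le) (auto intro: degree_smult_le)
      moreover have "coeff h1 (degree h) = 0"
        using lq by (simp add: h1_def mult.commute)
      ultimately have "degree h1 < degree h"
        using nz by (metis le_neq_implies_less leading_coeff_0_iff)
      from less.hyps[OF this h1 h1x] obtain c where c: "c \<noteq> 0" "g dvd smult c h1" by blast
      have "smult (c * lead_coeff g) h = smult c h1 + smult c q"
        by (metis eq smult_add_right smult_smult)
      then have "g dvd smult (c * lead_coeff g) h"
        using c \<open>g dvd q\<close> by (simp add: dvd_smult)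
      then show ?thesis using c g(2) by (intro exI[of _ "c * lead_coeff g"]) auto
    qed
  qed
qed

text \<open>
  This is the minimal polynomial of \<open>T\<close> over \<open>Frac N\<close>. By Gauss's lemma the primitive part of a polynomial
  of least degree divides \<open>t(X) - t(T)\<close>, whose leading coefficient is a unit. So the primitive part can be
  made monic, and its coefficients then are exact quotients of elements of \<open>N\<close>.
\<close>

lemma monic_minimal_polynomial:
  assumes t: "t \<in> N" "degree t > 0"
  obtains \<mu> where "\<mu> \<in> polys_over" "lead_coeff \<mu> = 1" "poly \<mu> [:0, 1:] = 0"
    "\<And>h. h \<in> polys_over \<Longrightarrow> poly h [:0, 1:] = 0 \<Longrightarrow> \<mu> dvd h"
proof -
  let ?P = "\<lambda>g. g \<in> polys_over \<and> g \<noteq> 0 \<and> poly g [:0, 1:] = 0"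
  have dt: "?P (diff_poly t)"
    using t degree_diff_poly[of t] by (auto simp: coeff_diff_poly_in poly_diff_poly_var)
  define g where "g = arg_min degree ?P"
  have g: "?P g" and min: "\<And>h. ?P h \<Longrightarrow> degree g \<le> degree h"
    using arg_min_nat_lemma[of ?P _ degree] dt unfolding g_def by blast+
  have dvd: "primitive_part g dvd h" if h: "h \<in> polys_over" "poly h [:0, 1:] = 0" for h
  proof -
    obtain c where c: "c \<noteq> 0" "g dvd smult c h"
      using dvd_multiple_of_minimal[of g "[:0, 1:]" h] g min h by blast
    have "fract_poly g dvd smult (to_fract c) (fract_poly h)"
      using fract_poly_dvd[OF c(2)] by simp
    then have "fract_poly g dvd fract_poly h"
      using c(1) by (simp add: dvd_smult_iff)
    moreover have "fract_poly g = smult (to_fract (content g)) (fract_poly (primitive_part g))"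
      by (metis content_times_primitive_part fract_poly_smult)
    ultimately have "fract_poly (primitive_part g) dvd fract_poly h"
      using g by (simp add: smult_dvd_iff)
    then show ?thesis
      using g by (intro fract_poly_dvdD) auto
  qed
  have "lead_coeff (diff_poly t) = [:lead_coeff t:]"
    using t by (simp add: degree_diff_poly coeff_diff_poly)
  moreover obtain q where "diff_poly t = primitive_part g * q"
    using dvd[of "diff_poly t"] dt by (auto elim: dvdE)
  ultimately have "lead_coeff (primitive_part g) dvd [:lead_coeff t:]"
    by (metis dvd_triv_left lead_coeff_mult)
  also have "[:lead_coeff t:] dvd 1"
    using t by (auto simp: is_unit_const_poly_iff dvd_field_iff)
  finally obtain \<kappa> where \<kappa>: "lead_coeff (primitive_part g) = [:\<kappa>:]" "\<kappa> \<noteq> 0"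
    by (metis is_unit_poly_iff not_is_unit_0)
  define \<mu> where "\<mu> = smult [:inverse \<kappa>:] (primitive_part g)"
  have pg: "primitive_part g = smult [:\<kappa>:] \<mu>"
    using \<kappa>(2) by (simp add: \<mu>_def flip: one_pCons)
  have lead: "lead_coeff \<mu> = 1"
    using \<kappa> by (simp add: \<mu>_def flip: one_pCons)
  have gm: "g = smult (content g * [:\<kappa>:]) \<mu>"
    by (metis content_times_primitive_part pg smult_smult)
  then have lg: "lead_coeff g = content g * [:\<kappa>:]"
    by (metis lead lead_coeff_smult mult.right_neutral)
  show thesis
  proof (rule that[of \<mu>])
    show "lead_coeff \<mu> = 1" by (fact lead)
    have "coeff \<mu> i \<in> N" for i
    proof (rule quotient_in)
      show "lead_coeff g \<in> N" using g by (auto simp: polys_over_def)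
      show "lead_coeff g \<noteq> 0" using g by auto
      have "coeff g i = lead_coeff g * coeff \<mu> i"
        by (metis coeff_smult gm lg)
      then show "lead_coeff g * coeff \<mu> i \<in> N"
        using g by (metis (mono_tags, lifting) polys_over_def mem_Collect_eq)
    qed
    then show "\<mu> \<in> polys_over" by (simp add: polys_over_def)
    have "poly g [:0, 1:] = lead_coeff g * poly \<mu> [:0, 1:]"
      by (metis gm lg poly_smult)
    then show "poly \<mu> [:0, 1:] = 0" using g by auto
  next
    fix h assume "h \<in> polys_over" "poly h [:0, 1:] = 0"
    from dvd[OF this] show "\<mu> dvd h"
      unfolding pg by (metis dvd_smult dvd_refl dvd_trans)
  qed
qed

text \<open>
  Let \<open>u\<close> be a coefficient of the minimal polynomial \<open>\<mu>(X, T)\<close> that has the largest degree in \<open>T\<close>. Since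
  \<open>u(X) - u(T)\<close> vanishes at \<open>X = T\<close>, it is a multiple of \<open>\<mu>\<close>; since both have the same degree in \<open>T\<close>, the
  cofactor involves \<open>X\<close> only. It divides the coefficient of the highest power of \<open>T\<close> in \<open>u(X) - u(T)\<close>, which
  is a nonzero constant, so \<open>\<mu>\<close> and \<open>u(X) - u(T)\<close> are associated.
\<close>

lemma coefficient_generates:
  assumes t: "t \<in> N" "degree t > 0"
  obtains u where "u \<in> N" "degree u > 0" "\<And>f. f \<in> N \<Longrightarrow> diff_poly u dvd diff_poly f"
proof -
  obtain \<mu> where \<mu>: "\<mu> \<in> polys_over" "lead_coeff \<mu> = 1" "poly \<mu> [:0, 1:] = 0"
    and dvd: "\<And>h. h \<in> polys_over \<Longrightarrow> poly h [:0, 1:] = 0 \<Longrightarrow> \<mu> dvd h"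
    using monic_minimal_polynomial[OF t] by blast
  define d where "d = Max (degree ` set (coeffs \<mu>))"
  have nz: "\<mu> \<noteq> 0" using \<mu>(2) by auto
  then have "d \<in> degree ` set (coeffs \<mu>)"
    unfolding d_def by (intro Max_in) auto
  then obtain u where u: "u \<in> set (coeffs \<mu>)" "degree u = d" by auto
  then obtain j where j: "u = coeff \<mu> j"
    by (metis in_set_conv_nth coeffs_nth length_coeffs_degree less_Suc_eq_le nz)
  have le_d: "degree (coeff \<mu> i) \<le> d" for i
  proof (cases "coeff \<mu> i = 0")
    case False
    then have "coeff \<mu> i \<in> set (coeffs \<mu>)"
      by (rule coeff_in_coeffs[OF nz le_degree])
    then show ?thesis unfolding d_def by (intro Max_ge) auto
  qed auto
  \<comment> \<open>Otherwise \<open>T\<close> would be a root of a nonzero polynomial with constant coefficients.\<close>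
  have dpos: "d > 0"
  proof (rule ccontr)
    assume "\<not> d > 0"
    then have "degree (coeff \<mu> i) = 0" for i using le_d[of i] by simp
    then have "coeff \<mu> i = [:coeff (coeff \<mu> i) 0:]" for i
      by (metis degree_0_id)
    then have "\<mu> = map_poly (\<lambda>a. [:a:]) (map_poly (\<lambda>c. coeff c 0) \<mu>)"
      by (intro poly_eqI) (simp add: coeff_map_poly)
    then have "pcompose (map_poly (\<lambda>c. coeff c 0) \<mu>) [:0, 1:] = poly \<mu> [:0, 1:]"
      by (simp add: pcompose_altdef)
    then have "map_poly (\<lambda>c. coeff c 0) \<mu> = 0"
      using \<mu>(3) by simp
    then have "coeff (lead_coeff \<mu>) 0 = 0"
      by (metis coeff_0 coeff_map_poly)
    then show False using \<mu>(2) by simp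
  qed
  have uN: "u \<in> N" using j \<mu>(1) by (auto simp: polys_over_def)
  then have "\<mu> dvd diff_poly u"
    by (intro dvd coeff_diff_poly_in poly_diff_poly_var)
  then obtain q where q: "diff_poly u = \<mu> * q" by (auto elim: dvdE)
  have unz: "diff_poly u \<noteq> 0"
    using u(2) dpos degree_diff_poly[of u] by auto
  \<comment> \<open>After the exchange of the variables, \<open>degree\<close> measures the degree in \<open>T\<close>.\<close>
  have sq: "swap_vars (diff_poly u) = swap_vars \<mu> * swap_vars q"
    by (simp add: q ring_hom_mult[OF is_ring_hom_swap_vars])
  have "degree (swap_vars (diff_poly u)) \<le> d"
    using u(2) by (intro degree_swap_vars_le) (auto simp: coeff_diff_poly intro!: degree_diff_le)
  moreover have sm: "degree (swap_vars \<mu>) \<ge> d"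
  proof (rule le_degree)
    have "coeff (coeff (swap_vars \<mu>) d) j \<noteq> 0"
      using u(2) dpos by (auto simp: coeff_swap_vars simp flip: j)
    then show "coeff (swap_vars \<mu>) d \<noteq> 0" by auto
  qed
  moreover have "swap_vars \<mu> \<noteq> 0" "swap_vars q \<noteq> 0"
    using unz q swap_vars_swap_vars ring_hom_0[OF is_ring_hom_swap_vars] by (metis mult_zero_left mult_zero_right)+
  ultimately have "degree (swap_vars q) = 0"
    by (simp add: sq degree_mult_eq)
  then obtain q0 where q0: "swap_vars q = [:q0:]" by (rule degree_eq_zeroE)
  have "coeff (swap_vars (diff_poly u)) d = [:- lead_coeff u:]"
  proof (rule poly_eqI)
    fix i show "coeff (coeff (swap_vars (diff_poly u)) d) i = coeff [:- lead_coeff u:] i"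
      using u(2) dpos
      by (cases i; cases d) (auto simp: coeff_swap_vars coeff_diff_poly)
  qed
  then have "coeff (swap_vars \<mu>) d * q0 = [:- lead_coeff u:]"
    by (simp add: sq q0 mult.commute)
  then have "q0 dvd [:- lead_coeff u:]" by (metis dvd_triv_right)
  also have "[:- lead_coeff u:] dvd 1"
    using u(2) dpos by (auto simp: is_unit_const_poly_iff dvd_field_iff)
  finally have "q0 dvd 1" .
  then obtain \<kappa> where \<kappa>: "q0 = [:\<kappa>:]" "\<kappa> \<noteq> 0"
    by (metis is_unit_poly_iff not_is_unit_0)
  have "q = [:[:\<kappa>:]:]"
  proof -
    have "swap_vars [:[:\<kappa>:]:] = [:[:\<kappa>:]:]"
      by (simp add: swap_vars_def map_poly_pCons)
    then show ?thesis by (metis q0 \<kappa>(1) swap_vars_swap_vars)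
  qed
  then have "diff_poly u = smult [:\<kappa>:] \<mu>" by (simp add: q)
  then have "\<mu> * k = diff_poly u * smult [:inverse \<kappa>:] k" for k
    using \<kappa>(2) by (simp flip: one_pCons)
  then have "diff_poly u dvd h" if "\<mu> dvd h" for h
    using that by (metis dvd_def)
  then show thesis
    using that[of u] uN u(2) dpos dvd by (simp add: coeff_diff_poly_in poly_diff_poly_var)
qed

text \<open>
  Polynomial form of Lueroth's theorem. Setting \<open>T = 0\<close> in \<open>u(X) - u(T) dvd f(X) - f(T)\<close> shows that
  \<open>u - u(0)\<close> divides \<open>f - f(0)\<close>. The quotient is again in \<open>N\<close> and has smaller degree than \<open>f\<close>, which allows
  an induction.
\<close>

theorem generated_by_one_polynomial:
  assumes t: "t \<in> N" "degree t > 0"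
  obtains u where "u \<in> N" "degree u > 0" "\<And>f. f \<in> N \<Longrightarrow> \<exists>g. f = pcompose g u"
proof -
  obtain u where u: "u \<in> N" "degree u > 0" "\<And>f. f \<in> N \<Longrightarrow> diff_poly u dvd diff_poly f"
    using coefficient_generates[OF t] by blast
  have ev: "map_poly (\<lambda>c. poly c 0) (diff_poly f) = f - [:coeff f 0:]" for f :: "'e poly"
    by (intro poly_eqI) (auto simp: coeff_map_poly coeff_diff_poly poly_0_coeff_0 coeff_pCons split: nat.splits)
  have dvd0: "u - [:coeff u 0:] dvd f - [:coeff f 0:]" if f: "f \<in> N" for f
  proof -
    obtain q where "diff_poly f = diff_poly u * q" using u(3)[OF f] by (auto elim: dvdE)
    then show ?thesis
      by (metis ev dvd_triv_left ring_hom_mult[OF is_ring_hom_map_poly[OF is_ring_hom_poly]])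
  qed
  have degu: "degree (u - [:a:]) = degree u" for a
    using u(2) by (metis (no_types, lifting) add_uminus_conv_diff degree_add_eq_left degree_minus degree_pCons_0)
  have "\<exists>g. f = pcompose g u" if "f \<in> N" for f
    using that
  proof (induction "degree f" arbitrary: f rule: less_induct)
    case less
    show ?case
    proof (cases "degree f = 0")
      case True
      then obtain a where "f = [:a:]" by (rule degree_eq_zeroE)
      then show ?thesis by (intro exI[of _ "[:a:]"]) simp
    next
      case False
      obtain f1 where f1: "f - [:coeff f 0:] = (u - [:coeff u 0:]) * f1"
        using dvd0[OF less.prems] by (auto elim: dvdE)
      have nz: "u - [:coeff u 0:] \<noteq> 0" using degu[of "coeff u 0"] u(2) by auto
      have "f1 \<in> N"
        by (rule quotient_in[OF _ nz]) (auto simp flip: f1 intro!: diff_in const_in u(1) less.prems)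
      moreover have "degree f1 < degree f"
      proof (cases "f1 = 0")
        case False
        then have "degree (f - [:coeff f 0:]) = degree u + degree f1"
          using nz by (simp add: f1 degree_mult_eq degu)
        moreover have "degree (f - [:coeff f 0:]) \<le> degree f"
          by (intro degree_diff_le) auto
        ultimately show ?thesis using u(2) by simp
      qed (use False in auto)
      ultimately obtain g where g: "f1 = pcompose g u" using less.hyps by blast
      have "f = [:coeff f 0:] + (u - [:coeff u 0:]) * f1" by (simp flip: f1)
      also have "\<dots> = pcompose ([:coeff f 0:] + ([:0, 1:] - [:coeff u 0:]) * g) u"
        by (simp only: g pcompose_add pcompose_mult pcompose_diff pcompose_const) (simp add: pcompose_pCons)
      finally show ?thesis by blast
    qed
  qed
  then show thesis using that u by blast
qed

end

section \<open>Derivations\<close>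

text \<open>
  Derivations with values in the target of a homomorphism \<open>\<theta>\<close>. Besides \<open>\<theta> = id\<close>, the case needed is
  \<open>\<theta> = exp (T d)\<close>, from a field \<open>E\<close> to \<open>E[[T]]\<close>.
\<close>

definition derivation_along :: "('a::comm_ring_1 \<Rightarrow> 'b::comm_ring_1) \<Rightarrow> ('a \<Rightarrow> 'b) \<Rightarrow> bool" where
  "derivation_along \<theta> \<delta> \<longleftrightarrow>
     (\<forall>x y. \<delta> (x + y) = \<delta> x + \<delta> y) \<and> (\<forall>x y. \<delta> (x * y) = \<delta> x * \<theta> y + \<theta> x * \<delta> y)"

lemma derivation_iff_along: "derivation D \<longleftrightarrow> derivation_along (\<lambda>x. x) D"
  by (simp add: derivation_def derivation_along_def)

context
  fixes \<theta> \<delta> :: "'a::idom \<Rightarrow> 'b::comm_ring_1"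
  assumes \<theta>: "is_ring_hom \<theta>" and \<delta>: "derivation_along \<theta> \<delta>"
begin

lemma along_add: "\<delta> (x + y) = \<delta> x + \<delta> y"
  and along_mult: "\<delta> (x * y) = \<delta> x * \<theta> y + \<theta> x * \<delta> y"
  using \<delta> by (auto simp: derivation_along_def)

lemma along_0: "\<delta> 0 = 0"
  using along_add[of 0 0] by simp

lemma along_uminus: "\<delta> (- x) = - \<delta> x"
  using along_add[of x "- x"] by (simp add: along_0 eq_neg_iff_add_eq_0 add.commute)

lemma along_diff: "\<delta> (x - y) = \<delta> x - \<delta> y"
  using along_add[of x "- y"] by (simp add: along_uminus)

lemma along_1: "\<delta> 1 = 0"
  using along_mult[of 1 1] by (simp add: ring_hom_1[OF \<theta>])

lemma along_sum: "\<delta> (sum f S) = (\<Sum>x\<in>S. \<delta> (f x))"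
  by (induction S rule: infinite_finite_induct) (auto simp: along_0 along_add)

lemma along_poly:
  "\<delta> (poly p x) = poly (map_poly \<delta> p) (\<theta> x) + \<theta> (poly (pderiv p) x) * \<delta> x"
proof (induction p)
  case 0
  then show ?case by (simp add: along_0 ring_hom_0[OF \<theta>])
next
  case (pCons a p)
  then show ?case
    by (simp add: map_poly_pCons along_0 along_add along_mult pderiv_pCons algebra_simps
        ring_hom_0[OF \<theta>] ring_hom_add[OF \<theta>] ring_hom_mult[OF \<theta>])
qed

end

lemmas is_ring_hom_id = is_ring_hom_def[of "\<lambda>x. x", simplified]

context
  fixes D :: "'a::idom \<Rightarrow> 'a"
  assumes D: "derivation D"
begin

lemmas derivation_add = along_add[OF is_ring_hom_id D[unfolded derivation_iff_along]]
lemmas derivation_mult = along_mult[OF is_ring_hom_id D[unfolded derivation_iff_along]]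
lemmas derivation_0 = along_0[OF is_ring_hom_id D[unfolded derivation_iff_along]]
lemmas derivation_1 = along_1[OF is_ring_hom_id D[unfolded derivation_iff_along]]
lemmas derivation_diff = along_diff[OF is_ring_hom_id D[unfolded derivation_iff_along]]
lemmas derivation_sum = along_sum[OF is_ring_hom_id D[unfolded derivation_iff_along]]

lemma derivation_power_Suc: "D (x ^ Suc n) = of_nat (Suc n) * x ^ n * D x"
  by (induction n) (simp_all add: derivation_mult algebra_simps)

lemma derivation_map_poly: "derivation (map_poly D)"
  unfolding derivation_def
  by (auto intro!: poly_eqI simp: coeff_map_poly derivation_0 derivation_add derivation_mult
      derivation_sum coeff_mult sum.distrib)

lemma map_poly_derivation_smult: "map_poly D (smult c f) = smult (D c) f + smult c (map_poly D f)"
  by (intro poly_eqI) (simp add: coeff_map_poly derivation_0 derivation_mult)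

end

lemma derivation_pderiv: "derivation (pderiv :: 'a::idom poly \<Rightarrow> _)"
  by (simp add: derivation_def pderiv_add pderiv_mult algebra_simps)

text \<open>
  The field to which this is applied is a fraction field \<open>'b fract\<close>, whose characteristic is a hypothesis on
  \<open>'b\<close> and not a property of its type class; therefore \<open>CHAR\<close> replaces the class of rings of characteristic
  zero.
\<close>

lemma degree_pderiv_char_0:
  fixes p :: "'a::idom poly"
  assumes "CHAR('a) = 0"
  shows "degree (pderiv p) = degree p - 1"
proof (cases "degree p")
  case 0
  then obtain a where "p = [:a:]" by (rule degree_eq_zeroE)
  then show ?thesis by simp
next
  case (Suc n)
  have "degree (pderiv p) \<le> n"
    using Suc by (intro degree_le) (auto simp: coeff_pderiv coeff_eq_0)
  moreover have "coeff p (Suc n) \<noteq> 0"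
    using Suc by (metis leading_coeff_0_iff degree_0 nat.distinct(1))
  then have "coeff (pderiv p) n \<noteq> 0"
    using assms by (auto simp: coeff_pderiv of_nat_eq_0_iff_char_dvd simp del: of_nat_Suc)
  ultimately show ?thesis using Suc le_degree by fastforce
qed

lemma pderiv_nonzero_char_0:
  fixes p :: "'a::idom poly"
  assumes "CHAR('a) = 0" "degree p > 0"
  shows "pderiv p \<noteq> 0"
proof
  assume "pderiv p = 0"
  then have "coeff (pderiv p) (degree p - 1) = 0" by simp
  then show False
    using assms by (auto simp: coeff_pderiv of_nat_eq_0_iff_char_dvd simp del: of_nat_Suc)
qed

section \<open>Descent to the constants of a set of derivations\<close>

lemma linear_polyE:
  assumes "degree (l :: 'a::comm_ring_1 poly) \<le> 1"
  obtains \<alpha> \<beta> where "l = [:\<alpha>, \<beta>:]"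
proof
  show "l = [:coeff l 0, coeff l 1:]"
    using assms by (intro poly_eqI) (auto simp: coeff_pCons coeff_eq_0 split: nat.splits)
qed

interpretation poly_vs: vector_space "smult :: 'e::field \<Rightarrow> 'e poly \<Rightarrow> 'e poly"
  by unfold_locales (simp_all add: smult_add_left smult_add_right)

abbreviation coord where "coord \<equiv> poly_vs.representation"

lemma span_mult_closed:
  fixes P :: "'e::field poly set"
  assumes "\<And>f g. f \<in> P \<Longrightarrow> g \<in> P \<Longrightarrow> f * g \<in> P"
    and "f \<in> poly_vs.span P" "g \<in> poly_vs.span P"
  shows "f * g \<in> poly_vs.span P"
  using assms(2)
proof (induction rule: poly_vs.span_induct_alt)
  case base
  then show ?case by (simp add: poly_vs.span_zero)
next
  case (step c x y)
  have "x * g \<in> poly_vs.span P"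
    using assms(3)
  proof (induction rule: poly_vs.span_induct_alt)
    case base
    then show ?case by (simp add: poly_vs.span_zero)
  next
    case (step c' x' y')
    then show ?case
      using assms(1)[OF \<open>x \<in> P\<close> \<open>x' \<in> P\<close>]
      by (simp add: distrib_left poly_vs.span_add poly_vs.span_scale poly_vs.span_base)
  qed
  then show ?case
    using step by (simp add: distrib_right poly_vs.span_add poly_vs.span_scale)
qed

text \<open>
  Membership in the span of a part of the basis, in the form in which minimal supports are compared later.
\<close>

lemma mem_span_subbasis_iff:
  fixes B :: "'e::field poly set"
  assumes "poly_vs.independent B" "B0 \<subseteq> B" "v \<in> poly_vs.span B"
  shows "v \<in> poly_vs.span B0 \<longleftrightarrow> (\<forall>b\<in>B - B0. coord B v b = 0)"
proof
  assume "v \<in> poly_vs.span B0"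
  then have "coord B v = coord B0 v"
    using assms poly_vs.representation_extend by blast
  then show "\<forall>b\<in>B - B0. coord B v b = 0"
    using poly_vs.representation_ne_zero[of B0 v] by auto
next
  assume "\<forall>b\<in>B - B0. coord B v b = 0"
  then have "{b. coord B v b \<noteq> 0} \<subseteq> B0"
    using poly_vs.representation_ne_zero[of B v] by auto
  then have "(\<Sum>b | coord B v b \<noteq> 0. smult (coord B v b) b) \<in> poly_vs.span B0"
    by (intro poly_vs.span_sum poly_vs.span_scale poly_vs.span_base) auto
  then show "v \<in> poly_vs.span B0"
    using assms by (simp add: poly_vs.sum_nonzero_representation_eq)
qed

text \<open>
  The derivations in \<open>Der\<close> act on \<open>E[T]\<close> through the coefficients. The hypothesis \<open>parallel\<close> says that
  \<open>D f = w f'\<close> for all \<open>f \<in> P\<close>, with the rational function \<open>w = (D t) / t'\<close> that depends on \<open>D\<close> only. So the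
  elements of \<open>P\<close> are horizontal for the operator \<open>D - w d/dT\<close>.
\<close>

locale horizontal_subring =
  fixes P :: "'e::field_gcd poly set" and Der :: "('e \<Rightarrow> 'e) set" and t :: "'e poly"
  assumes char: "CHAR('e) = 0"
    and der: "D \<in> Der \<Longrightarrow> derivation D"
    and const_in: "(\<And>D. D \<in> Der \<Longrightarrow> D a = 0) \<Longrightarrow> [:a:] \<in> P"
    and diff_in: "f \<in> P \<Longrightarrow> g \<in> P \<Longrightarrow> f - g \<in> P"
    and mult_in: "f \<in> P \<Longrightarrow> g \<in> P \<Longrightarrow> f * g \<in> P"
    and t_in: "t \<in> P" and degree_t: "degree t > 0"
    and parallel: "D \<in> Der \<Longrightarrow> f \<in> P \<Longrightarrow>
      pderiv t * map_poly D f = map_poly D t * pderiv f"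
begin

lemma zero_in: "0 \<in> P"
  using const_in[of 0] derivation_0[OF der] by simp

lemma add_in: "f \<in> P \<Longrightarrow> g \<in> P \<Longrightarrow> f + g \<in> P"
  using diff_in[of f "0 - g"] diff_in[of 0 g] zero_in by simp

lemma sum_in: "(\<And>x. x \<in> S \<Longrightarrow> f x \<in> P) \<Longrightarrow> sum f S \<in> P"
  by (induction S rule: infinite_finite_induct) (auto simp: zero_in add_in)

lemma smult_in: "(\<And>D. D \<in> Der \<Longrightarrow> D a = 0) \<Longrightarrow> f \<in> P \<Longrightarrow> smult a f \<in> P"
  using mult_in[OF const_in, of a f] by simp

text \<open>
  Since \<open>P\<close> is only closed under multiplication by common constants, the linear algebra takes place in its
  \<open>E\<close>-span.
\<close>

abbreviation R where "R \<equiv> poly_vs.span P"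

lemma one_in: "1 \<in> P"
  using const_in[of 1] derivation_1[OF der] by (simp add: one_pCons)

lemma R_mult: "f \<in> R \<Longrightarrow> g \<in> R \<Longrightarrow> f * g \<in> R"
  by (rule span_mult_closed) (auto intro: mult_in)

lemma R_const: "[:a:] \<in> R"
  using poly_vs.span_scale[OF poly_vs.span_base[OF one_in], of a] by (simp add: one_pCons)

end

text \<open>
  Every polynomial is a quotient of two elements of \<open>R\<close>, that is, \<open>Frac R = E(T)\<close>. Without this the
  connection can have poles, at the ramification points of the map from the line given by \<open>P\<close>.
\<close>

locale birational_horizontal_subring = horizontal_subring +
  assumes full: "\<exists>b\<in>R. b \<noteq> 0 \<and> c * b \<in> R"
begin

text \<open>
  The operator \<open>D - (p/q) d/dT\<close> kills \<open>P\<close> and obeys the Leibniz rule for scalars, so on the span it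
  applies \<open>D\<close> to the scalars. In particular it maps the span to itself, although \<open>p/q\<close> may have poles.
\<close>

lemma twisted_derivative_in_span:
  assumes D: "derivation D" and pq: "\<And>f. f \<in> P \<Longrightarrow> q * map_poly D f = p * pderiv f"
    and y: "y \<in> R"
  shows "\<exists>z\<in>R. q * z = q * map_poly D y - p * pderiv y"
  using y
proof (induction rule: poly_vs.span_induct_alt)
  case base
  then show ?case by (intro bexI[of _ 0]) (auto simp: poly_vs.span_zero)
next
  case (step c x y)
  then obtain z where z: "z \<in> R" "q * z = q * map_poly D y - p * pderiv y" by blast
  show ?case
  proof (intro bexI[of _ "smult (D c) x + z"])
    have "q * map_poly D (smult c x + y) - p * pderiv (smult c x + y) =
      q * smult (D c) x + smult c (q * map_poly D x - p * pderiv x)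
      + (q * map_poly D y - p * pderiv y)"
      by (simp add: derivation_add[OF derivation_map_poly[OF D]] map_poly_derivation_smult[OF D]
          pderiv_add pderiv_smult algebra_simps smult_diff_right)
    moreover have "q * map_poly D x - p * pderiv x = 0"
      using pq[OF step(1)] by simp
    ultimately show "q * (smult (D c) x + z) =
      q * map_poly D (smult c x + y) - p * pderiv (smult c x + y)"
      by (simp only: z(2) smult_0_right add_0_right distrib_left)
    show "smult (D c) x + z \<in> R"
      by (intro poly_vs.span_add poly_vs.span_scale poly_vs.span_base[OF step(1)] z(1))
  qed
qed

text \<open>
  Locally at a pole of \<open>p/q\<close> the term \<open>(p/q) y'\<close> dominates. If \<open>y\<close> has order \<open>m + 1\<close> then \<open>y'\<close> has order
  exactly \<open>m\<close>, in characteristic zero, whereas \<open>D\<close> lowers the order by at most one before the factor \<open>q\<close>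
  raises it again.
\<close>

lemma multiplicity_twisted_derivative:
  fixes y z p q \<pi> :: "'a poly"
  assumes D: "derivation D" and cop: "coprime p q" and \<pi>: "prime \<pi>" "\<pi> dvd q" and q: "q \<noteq> 0"
    and y: "y \<noteq> 0" "\<pi> dvd y"
    and z: "q * z = q * map_poly D y - p * pderiv y"
  shows "z \<noteq> 0 \<and> multiplicity \<pi> y = multiplicity \<pi> z + multiplicity \<pi> q + 1"
proof -
  have nu: "\<not> is_unit \<pi>" "\<pi> \<noteq> 0" "prime_elem \<pi>" using \<pi> by (auto simp: not_prime_unit)
  obtain y0 where y0: "y = \<pi> ^ multiplicity \<pi> y * y0" "\<not> \<pi> dvd y0"
    using multiplicity_decompose'[OF y(1) nu(1)] by metis
  have "multiplicity \<pi> y \<noteq> 0"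
    using y nu by (simp add: multiplicity_eq_zero_iff)
  then obtain m where m: "multiplicity \<pi> y = Suc m" by (cases "multiplicity \<pi> y") auto
  obtain q1 where q1: "q = \<pi> * q1" using \<pi> by (auto elim: dvdE)
  have degpi: "degree \<pi> > 0"
    using nu(1,2) by (auto simp: is_unit_iff_degree)
  have "\<not> \<pi> dvd pderiv \<pi>"
  proof
    assume "\<pi> dvd pderiv \<pi>"
    then have "degree \<pi> \<le> degree (pderiv \<pi>)"
      by (rule dvd_imp_degree_le) (rule pderiv_nonzero_char_0[OF char degpi])
    then show False using degpi by (simp add: degree_pderiv_char_0[OF char])
  qed
  moreover have "\<not> \<pi> dvd p"
    using cop \<pi>(2) nu(1) by (metis coprime_common_divisor)
  moreover have "\<not> \<pi> dvd of_nat (Suc m)"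
  proof
    assume "\<pi> dvd of_nat (Suc m)"
    then have "\<pi> dvd [:of_nat (Suc m):]" by (simp only: of_nat_poly)
    moreover have "[:of_nat (Suc m):] \<noteq> (0 :: 'a poly)"
      using char by (simp add: of_nat_eq_0_iff_char_dvd del: of_nat_Suc)
    ultimately have "degree \<pi> \<le> degree [:of_nat (Suc m) :: 'a:]"
      by (rule dvd_imp_degree_le)
    then show False using degpi by simp
  qed
  ultimately have nd: "\<not> \<pi> dvd of_nat (Suc m) * p * y0 * pderiv \<pi>"
    using y0(2) by (simp add: prime_elem_dvd_mult_iff[OF nu(3)] del: of_nat_Suc)
  define X where "X = q1 * (of_nat (Suc m) * map_poly D \<pi> * y0 + \<pi> * map_poly D y0) - p * pderiv y0"
  define \<omega> where "\<omega> = \<pi> * X - of_nat (Suc m) * p * y0 * pderiv \<pi>"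
  have y1: "y = \<pi> ^ Suc m * y0" using y0(1) m by simp
  have "q * z = \<pi> ^ m * \<omega>"
    unfolding z unfolding y1
    by (simp add: derivation_mult[OF derivation_map_poly[OF D]]
        derivation_power_Suc[OF derivation_map_poly[OF D]] derivation_mult[OF derivation_pderiv]
        derivation_power_Suc[OF derivation_pderiv] X_def \<omega>_def q1 del: of_nat_Suc power_Suc)
      (simp add: algebra_simps)
  moreover have w: "\<not> \<pi> dvd \<omega>"
  proof
    assume "\<pi> dvd \<omega>"
    then have "\<pi> dvd \<pi> * X - \<omega>" by (intro dvd_diff dvd_triv_left)
    with nd show False by (simp only: \<omega>_def diff_diff_eq2 add_diff_cancel_left')
  qed
  then have "\<omega> \<noteq> 0" by auto
  ultimately have "z \<noteq> 0" using nu by auto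
  moreover have "multiplicity \<pi> (q * z) = multiplicity \<pi> q + multiplicity \<pi> z"
    using q \<open>z \<noteq> 0\<close> nu by (simp add: prime_elem_multiplicity_mult_distrib)
  moreover have "multiplicity \<pi> (\<pi> ^ m * \<omega>) = m"
    using w nu by (simp add: prime_elem_multiplicity_mult_distrib \<open>\<omega> \<noteq> 0\<close> not_dvd_imp_multiplicity_0)
  ultimately show ?thesis
    using m \<open>q * z = \<pi> ^ m * \<omega>\<close> by simp
qed

text \<open>
  At a pole \<open>\<pi>\<close> of order \<open>r\<close>, the order of every nonzero element of \<open>R\<close> would be a multiple of \<open>r + 1\<close>: the
  operator lowers positive orders by \<open>r + 1\<close> and never leaves \<open>R\<close>, which contains no element of negative order.
  But \<open>\<pi>\<close> itself, of order one, is a quotient of elements of \<open>R\<close>. The degree bound follows from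
  \<open>degree (D t) \<le> degree t\<close>.
\<close>

lemma polynomial_connection:
  assumes D: "D \<in> Der"
  shows "\<exists>w. degree w \<le> 1 \<and> (\<forall>f\<in>P. map_poly D f = w * pderiv f)"
proof -
  note dD = der[OF D]
  have t': "pderiv t \<noteq> 0" by (rule pderiv_nonzero_char_0[OF char degree_t])
  define g where "g = gcd (map_poly D t) (pderiv t)"
  have g: "g \<noteq> 0" using t' by (simp add: g_def)
  then obtain p q where pq: "map_poly D t = p * g" "pderiv t = q * g" "coprime p q"
    unfolding g_def using gcd_coprime_exists by blast
  have q0: "q \<noteq> 0" using pq(2) t' by auto
  have rel: "q * map_poly D f = p * pderiv f" if "f \<in> P" for f
  proof -
    have "g * (q * map_poly D f) = g * (p * pderiv f)"
      using parallel[OF D that] by (simp add: pq algebra_simps)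
    then show ?thesis using g by simp
  qed
  have "is_unit q"
  proof (rule ccontr)
    assume "\<not> is_unit q"
    then obtain \<pi> where \<pi>: "prime \<pi>" "\<pi> dvd q" using prime_divisorE[OF q0] by blast
    define r where "r = multiplicity \<pi> q"
    have "r > 0"
      using \<pi> q0 by (auto simp: r_def multiplicity_gt_zero_iff not_prime_unit)
    have dvd: "Suc r dvd multiplicity \<pi> y" if "y \<in> R" "y \<noteq> 0" for y
      using that
    proof (induction "multiplicity \<pi> y" arbitrary: y rule: less_induct)
      case less
      show ?case
      proof (cases "\<pi> dvd y")
        case False
        then show ?thesis by (simp add: not_dvd_imp_multiplicity_0)
      next
        case True
        obtain z where z: "z \<in> R" "q * z = q * map_poly D y - p * pderiv y"
          using twisted_derivative_in_span[OF dD rel less.prems(1)] by blast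
        have *: "z \<noteq> 0" "multiplicity \<pi> y = multiplicity \<pi> z + Suc r"
          using multiplicity_twisted_derivative[OF dD pq(3) \<pi> q0 less.prems(2) True z(2)]
          by (simp_all add: r_def)
        then have "Suc r dvd multiplicity \<pi> z" using less.hyps[of z] z(1) by simp
        then show ?thesis unfolding *(2) by (intro dvd_add dvd_refl)
      qed
    qed
    obtain b where b: "b \<in> R" "b \<noteq> 0" "\<pi> * b \<in> R" using full by blast
    have "\<pi> \<noteq> 0" "prime_elem \<pi>" using \<pi> by auto
    then have "multiplicity \<pi> (\<pi> * b) = 1 + multiplicity \<pi> b"
      using b by (simp add: prime_elem_multiplicity_mult_distrib)
    moreover have "Suc r dvd multiplicity \<pi> (\<pi> * b)" "Suc r dvd multiplicity \<pi> b"
      using b \<open>\<pi> \<noteq> 0\<close> by (auto intro!: dvd)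
    ultimately have "Suc r dvd 1" by (metis dvd_add_left_iff)
    then show False using \<open>r > 0\<close> by simp
  qed
  then obtain \<kappa> where \<kappa>: "q = [:\<kappa>:]" "\<kappa> \<noteq> 0" by (metis is_unit_poly_iff not_is_unit_0)
  define w where "w = smult (inverse \<kappa>) p"
  have w: "map_poly D f = w * pderiv f" if "f \<in> P" for f
  proof -
    have "smult (inverse \<kappa>) (smult \<kappa> (map_poly D f)) = smult (inverse \<kappa>) (p * pderiv f)"
      using rel[OF that] \<kappa> by simp
    then show ?thesis using \<kappa> by (simp add: w_def)
  qed
  have "degree w \<le> 1"
  proof (cases "w = 0")
    case False
    then have "degree (map_poly D t) = degree w + (degree t - 1)"
      using t' by (simp add: w[OF t_in] degree_mult_eq degree_pderiv_char_0[OF char])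
    moreover have "degree (map_poly D t) \<le> degree t"
      by (rule degree_le) (simp add: coeff_map_poly derivation_0[OF dD] coeff_eq_0)
    ultimately show ?thesis using degree_t by simp
  qed simp
  with w show ?thesis by blast
qed

definition connection :: "('a \<Rightarrow> 'a) \<Rightarrow> 'a poly" where
  "connection D = (SOME w. degree w \<le> 1 \<and> (\<forall>f\<in>P. map_poly D f = w * pderiv f))"

lemma connection:
  assumes "D \<in> Der"
  shows "degree (connection D) \<le> 1" "f \<in> P \<Longrightarrow> map_poly D f = connection D * pderiv f"
  using someI_ex[OF polynomial_connection[OF assms]] unfolding connection_def by blast+

text \<open>
  The operator \<open>\<nabla>\<^sub>D = D - w\<^sub>D d/dT\<close> that kills \<open>P\<close>.
\<close>

definition covariant :: "('a \<Rightarrow> 'a) \<Rightarrow> 'a poly \<Rightarrow> 'a poly" where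
  "covariant D y = map_poly D y - connection D * pderiv y"

lemma derivation_covariant: "D \<in> Der \<Longrightarrow> derivation (covariant D)"
  unfolding derivation_def covariant_def
  using derivation_map_poly[OF der, unfolded derivation_def]
  by (simp add: pderiv_add pderiv_mult algebra_simps)

lemma covariant_smult:
  "D \<in> Der \<Longrightarrow> covariant D (smult c y) = smult (D c) y + smult c (covariant D y)"
  by (simp add: covariant_def map_poly_derivation_smult[OF der] pderiv_smult smult_diff_right)

lemma covariant_P: "D \<in> Der \<Longrightarrow> f \<in> P \<Longrightarrow> covariant D f = 0"
  by (simp add: covariant_def connection(2))

lemma coord_covariant:
  assumes B: "poly_vs.independent B" "B \<subseteq> P" and D: "D \<in> Der" and y: "y \<in> poly_vs.span B"
  shows "covariant D y \<in> poly_vs.span B \<and> coord B (covariant D y) = (\<lambda>b. D (coord B y b))"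
proof -
  have "y \<in> poly_vs.span B \<and> covariant D y \<in> poly_vs.span B \<and>
    coord B (covariant D y) = (\<lambda>b. D (coord B y b))"
    using y
  proof (induction rule: poly_vs.span_induct_alt)
    case base
    then show ?case
      by (simp add: derivation_0[OF derivation_covariant[OF D]] derivation_0[OF der[OF D]]
          poly_vs.span_zero poly_vs.representation_zero)
  next
    case (step c x y)
    have x: "x \<in> poly_vs.span B" "x \<in> P" using step B by (auto intro: poly_vs.span_base)
    have eq: "covariant D (smult c x + y) = smult (D c) x + covariant D y"
      by (simp add: derivation_add[OF derivation_covariant[OF D]] covariant_smult[OF D]
          covariant_P[OF D x(2)])
    show ?case
      unfolding eq using step x B(1)
      by (auto intro!: poly_vs.span_add poly_vs.span_scale ext
          simp: poly_vs.representation_add poly_vs.span_scale poly_vs.representation_scale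
            poly_vs.representation_basis derivation_add[OF der[OF D]] derivation_mult[OF der[OF D]]
            derivation_0[OF der[OF D]] derivation_1[OF der[OF D]])
  qed
  then show ?thesis by blast
qed

text \<open>
  Choose a vector of \<open>V\<close> outside the span of \<open>B0\<close> whose support outside \<open>B0\<close> is as small as possible, scaled
  such that one of these coordinates is \<open>1\<close>. Its covariant derivative is again in \<open>V\<close> and has smaller support
  outside \<open>B0\<close>, because the coordinate \<open>1\<close> is differentiated to \<open>0\<close>. So all these coordinates are constants.
\<close>

lemma constant_coordinates:
  assumes B: "poly_vs.independent B" "B \<subseteq> P" and B0: "B0 \<subseteq> B"
    and V: "poly_vs.subspace V" "V \<subseteq> poly_vs.span B"
    and stable: "\<And>D v. D \<in> Der \<Longrightarrow> v \<in> V \<Longrightarrow> covariant D v \<in> V"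
    and v0: "v0 \<in> V" "v0 \<notin> poly_vs.span B0"
  obtains v where "v \<in> V" "v \<notin> poly_vs.span B0"
    "\<And>D b. D \<in> Der \<Longrightarrow> b \<in> B - B0 \<Longrightarrow> D (coord B v b) = 0"
proof -
  define supp where "supp v = {b. coord B v b \<noteq> 0} - B0" for v
  have fin: "finite (supp v)" for v unfolding supp_def using poly_vs.finite_representation[of B v] by auto
  have in_span: "v \<in> poly_vs.span B0 \<longleftrightarrow> supp v = {}" if "v \<in> V" for v
    using mem_span_subbasis_iff[OF B(1) B0, of v] V(2) that poly_vs.representation_ne_zero[of B v]
    by (auto simp: supp_def)
  let ?Q = "\<lambda>v. v \<in> V \<and> v \<notin> poly_vs.span B0"
  define v1 where "v1 = arg_min (\<lambda>v. card (supp v)) ?Q"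
  have v1: "?Q v1" and min: "\<And>v. ?Q v \<Longrightarrow> card (supp v1) \<le> card (supp v)"
    using arg_min_nat_lemma[of ?Q v0 "\<lambda>v. card (supp v)"] v0 unfolding v1_def by blast+
  obtain b1 where b1: "b1 \<in> supp v1" using in_span v1 by auto
  define c where "c = inverse (coord B v1 b1)"
  have c: "c \<noteq> 0" using b1 by (simp add: c_def supp_def)
  define v where "v = smult c v1"
  have vV: "v \<in> V" using v1 V(1) by (auto simp: v_def intro: poly_vs.subspace_scale)
  have coord_v: "coord B v b = c * coord B v1 b" for b
    using V(2) v1 B(1) by (auto simp: v_def poly_vs.representation_scale)
  then have supp_v: "supp v = supp v1" using c by (auto simp: supp_def)
  have one: "coord B v b1 = 1" using b1 by (simp add: coord_v c_def supp_def)
  show thesis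
  proof (rule that[OF vV])
    show "v \<notin> poly_vs.span B0" using in_span vV v1 supp_v by auto
    fix D b assume D: "D \<in> Der" and b: "b \<in> B - B0"
    have rep: "coord B (covariant D v) = (\<lambda>b. D (coord B v b))"
      using coord_covariant[OF B D] vV V(2) by blast
    have "supp (covariant D v) \<subseteq> supp v1 - {b1}"
      using one by (auto simp: supp_def rep coord_v c derivation_1[OF der[OF D]] derivation_0[OF der[OF D]]
          intro: ccontr)
    then have "card (supp (covariant D v)) < card (supp v1)"
      using fin b1 by (meson card_Diff1_less card_mono finite_Diff le_less_trans)
    then have "covariant D v \<in> poly_vs.span B0"
      using min[of "covariant D v"] stable[OF D vV] by auto
    then have "supp (covariant D v) = {}" using in_span stable[OF D vV] by auto
    then show "D (coord B v b) = 0" using b by (auto simp: supp_def rep)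
  qed
qed

lemma in_P_if_constant_coordinates:
  assumes B: "poly_vs.independent B" "B \<subseteq> P" "v \<in> poly_vs.span B"
    and c: "\<And>D b. D \<in> Der \<Longrightarrow> b \<in> B \<Longrightarrow> D (coord B v b) = 0"
  shows "v \<in> P"
proof -
  have "(\<Sum>b | coord B v b \<noteq> 0. smult (coord B v b) b) \<in> P"
    using B c poly_vs.representation_ne_zero[of B v] by (intro sum_in smult_in) auto
  then show ?thesis using B by (simp add: poly_vs.sum_nonzero_representation_eq)
qed

text \<open>
  The elements \<open>y\<close> of \<open>R\<close> with \<open>T y \<in> R\<close> form a stable subspace because \<open>\<nabla>\<^sub>D T = - w\<^sub>D\<close> has degree at most
  one. It is nonzero by birationality, and hence contains a nonzero element of \<open>P\<close>.
\<close>

lemma multiplier_to_linear: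
  obtains b where "b \<in> P" "b \<noteq> 0" "[:0, 1:] * b \<in> R"
proof -
  obtain B where B: "B \<subseteq> P" "poly_vs.independent B" "P \<subseteq> poly_vs.span B"
    using poly_vs.maximal_independent_subset[of P] by blast
  have span: "poly_vs.span B = R"
    using B by (metis poly_vs.span_eq poly_vs.span_superset subset_trans)
  let ?V = "{y \<in> R. [:0, 1:] * y \<in> R}"
  have sub: "poly_vs.subspace ?V"
    by (rule poly_vs.subspaceI)
      (auto simp: poly_vs.span_zero distrib_left poly_vs.span_add intro: poly_vs.span_scale
        simp del: mult_pCons_left)
  have stable: "covariant D y \<in> ?V" if D: "D \<in> Der" and y: "y \<in> ?V" for D y
  proof -
    have R: "covariant D z \<in> R" if "z \<in> R" for z
      using coord_covariant[OF B(2,1) D] that span by auto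
    obtain \<alpha> \<beta> where w: "connection D = [:\<alpha>, \<beta>:]"
      using connection(1)[OF D] by (rule linear_polyE)
    have "covariant D [:0, 1:] = - connection D"
      by (simp add: covariant_def map_poly_pCons derivation_0[OF der[OF D]] derivation_1[OF der[OF D]]
          pderiv_pCons)
    then have "covariant D ([:0, 1:] * y) = [:0, 1:] * covariant D y - (smult \<alpha> y + smult \<beta> ([:0, 1:] * y))"
      unfolding derivation_mult[OF derivation_covariant[OF D]] by (simp add: w algebra_simps)
    then have "[:0, 1:] * covariant D y = covariant D ([:0, 1:] * y) + (smult \<alpha> y + smult \<beta> ([:0, 1:] * y))"
      by (simp add: algebra_simps del: mult_pCons_left)
    also have "\<dots> \<in> R" using y R by (auto intro!: poly_vs.span_add poly_vs.span_scale simp del: mult_pCons_left)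
    finally show ?thesis using y R by (simp del: mult_pCons_left)
  qed
  obtain b0 where b0: "b0 \<in> R" "b0 \<noteq> 0" "[:0, 1:] * b0 \<in> R" using full by blast
  obtain v where "v \<in> ?V" "v \<notin> poly_vs.span {}"
    "\<And>D b. D \<in> Der \<Longrightarrow> b \<in> B - {} \<Longrightarrow> D (coord B v b) = 0"
    by (rule constant_coordinates[OF B(2,1) _ sub _ stable, of "{}" b0]) (use b0 span in auto)
  then show thesis
    using in_P_if_constant_coordinates[OF B(2,1), of v] span that[of v] by auto
qed

text \<open>
  With \<open>b\<close> as in the previous lemma, the multiples \<open>b l\<close> of \<open>b\<close> with \<open>degree l \<le> 1\<close> form a stable subspace
  of \<open>R\<close>. Taking \<open>B0 = {b}\<close> excludes the trivial solution \<open>l = 1\<close> and produces \<open>l\<close> of degree one such that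
  \<open>b l\<close> has constant coordinates, except possibly the coordinate at \<open>b\<close>. Subtracting that coordinate from
  \<open>l\<close> gives \<open>u\<close>.
\<close>

lemma constant_linear_polynomial:
  obtains u b where "degree u = 1" "b \<in> P" "b \<noteq> 0" "b * u \<in> P" "\<And>D. D \<in> Der \<Longrightarrow> covariant D u = 0"
proof -
  obtain b where b: "b \<in> P" "b \<noteq> 0" "[:0, 1:] * b \<in> R"
    by (rule multiplier_to_linear)
  obtain B where B: "{b} \<subseteq> B" "B \<subseteq> P" "poly_vs.independent B" "P \<subseteq> poly_vs.span B"
    using poly_vs.maximal_independent_subset_extend[of "{b}" P] b by auto
  have span: "poly_vs.span B = R"
    using B by (metis poly_vs.span_eq poly_vs.span_superset subset_trans)
  let ?V = "{b * l | l. degree l \<le> 1}"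
  have sub: "poly_vs.subspace ?V"
  proof (rule poly_vs.subspaceI)
    show "0 \<in> ?V" by (auto intro!: exI[of _ 0])
    show "x + y \<in> ?V" if "x \<in> ?V" "y \<in> ?V" for x y
    proof -
      from that obtain l m where "x = b * l" "y = b * m" "degree l \<le> 1" "degree m \<le> 1" by auto
      then show ?thesis by (auto intro!: exI[of _ "l + m"] degree_add_le simp: distrib_left)
    qed
    show "smult c x \<in> ?V" if "x \<in> ?V" for c x
    proof -
      from that obtain l where "x = b * l" "degree l \<le> 1" by auto
      then show ?thesis by (auto intro!: exI[of _ "smult c l"] intro: order_trans[OF degree_smult_le])
    qed
  qed
  have VR: "?V \<subseteq> R"
  proof clarify
    fix l :: "'a poly" assume "degree l \<le> 1"
    then obtain \<alpha> \<beta> where "l = [:\<alpha>, \<beta>:]" by (rule linear_polyE)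
    then have "b * l = smult \<alpha> b + smult \<beta> ([:0, 1:] * b)" by simp
    then show "b * l \<in> R"
      using poly_vs.span_add[OF poly_vs.span_scale[OF poly_vs.span_base[OF b(1)]] poly_vs.span_scale[OF b(3)]]
      by (simp only:)
  qed
  have cov_le: "degree (covariant D l) \<le> 1" if D: "D \<in> Der" and l: "degree l \<le> 1" for D and l :: "'a poly"
  proof -
    have "degree (map_poly D l) \<le> 1"
      using l by (intro degree_le) (simp add: coeff_map_poly derivation_0[OF der[OF D]] coeff_eq_0)
    moreover have "degree (connection D * pderiv l) \<le> 1"
      using connection(1)[OF D] l degree_mult_le[of "connection D" "pderiv l"]
      by (simp add: degree_pderiv_char_0[OF char])
    ultimately show ?thesis unfolding covariant_def by (rule degree_diff_le)
  qed
  have cov_b: "covariant D (b * l) = b * covariant D l" if "D \<in> Der" for D l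
    by (simp add: derivation_mult[OF derivation_covariant[OF that]] covariant_P[OF that b(1)])
  have stable: "covariant D v \<in> ?V" if "D \<in> Der" "v \<in> ?V" for D v
    using that cov_b[OF that(1)] cov_le[OF that(1)] by auto
  have v0: "b * [:0, 1:] \<notin> poly_vs.span {b}"
  proof
    assume "b * [:0, 1:] \<in> poly_vs.span {b}"
    then obtain k where "b * [:0, 1:] = smult k b" by (auto simp: poly_vs.span_singleton simp del: mult_pCons_right)
    then have "b * [:0, 1:] = b * [:k:]" by simp
    then have "[:0, 1:] = [:k:]" using b(2) by (metis mult_left_cancel)
    then show False by simp
  qed
  have Vspan: "?V \<subseteq> poly_vs.span B" using VR span by simp
  have v0V: "b * [:0, 1:] \<in> ?V" by (intro CollectI exI[of _ "[:0, 1:]"]) simp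
  obtain v where v: "v \<in> ?V" "v \<notin> poly_vs.span {b}"
    "\<And>D x. D \<in> Der \<Longrightarrow> x \<in> B - {b} \<Longrightarrow> D (coord B v x) = 0"
    by (rule constant_coordinates[OF B(3,2,1) sub Vspan stable v0V v0]) (assumption | rule that)+
  from v(1) obtain l where l: "v = b * l" "degree l \<le> 1" by auto
  define k where "k = coord B v b"
  define u where "u = l - [:k:]"
  have bB: "b \<in> poly_vs.span B" "b \<in> B" using B by (auto intro: poly_vs.span_base)
  have vB: "v \<in> poly_vs.span B" using v(1) VR span by blast
  have bu: "b * u = v - smult k b" by (simp add: u_def l algebra_simps)
  have buR: "b * u \<in> poly_vs.span B"
    unfolding bu using vB bB by (intro poly_vs.span_diff poly_vs.span_scale)
  have "coord B (b * u) x = coord B v x - (if x = b then k else 0)" for x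
    unfolding bu using vB bB B(3)
    by (simp add: poly_vs.representation_diff poly_vs.representation_scale poly_vs.span_scale
        poly_vs.representation_basis)
  then have "D (coord B (b * u) x) = 0" if "D \<in> Der" "x \<in> B" for D x
    using v(3)[OF that(1), of x] that by (auto simp: k_def derivation_0[OF der])
  then have buP: "b * u \<in> P"
    by (intro in_P_if_constant_coordinates[OF B(3,2) buR])
  have "degree u = 1"
  proof (rule ccontr)
    assume "degree u \<noteq> 1"
    moreover have "degree u \<le> 1" unfolding u_def using l by (intro degree_diff_le) auto
    ultimately have "degree u = 0" by simp
    then obtain a where "u = [:a:]" by (rule degree_eq_zeroE)
    then have "v = smult (a + k) b" using bu by (simp add: algebra_simps smult_add_left)
    then show False using v(2) by (simp add: poly_vs.span_scale poly_vs.span_base)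
  qed
  moreover have "covariant D u = 0" if "D \<in> Der" for D
    using cov_b[OF that, of u] covariant_P[OF that buP] b(2) by simp
  ultimately show thesis using that b buP by blast
qed

text \<open>
  Since \<open>\<nabla>\<^sub>D u = 0\<close>, applying \<open>\<nabla>\<^sub>D\<close> to \<open>\<psi>(u)\<close> amounts to applying \<open>D\<close> to the coefficients of \<open>\<psi>\<close>.
\<close>

lemma birational_descent:
  obtains u b where "degree u = 1" "b \<in> P" "b \<noteq> 0" "b * u \<in> P"
    "\<And>f. f \<in> P \<Longrightarrow> \<exists>\<psi>. (\<forall>i. \<forall>D\<in>Der. D (coeff \<psi> i) = 0) \<and> f = pcompose \<psi> u"
proof -
  obtain u b where u: "degree u = 1" "b \<in> P" "b \<noteq> 0" "b * u \<in> P"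
    and cov: "\<And>D. D \<in> Der \<Longrightarrow> covariant D u = 0"
    by (rule constant_linear_polynomial) blast
  obtain \<beta> \<alpha> where ub: "u = [:\<beta>, \<alpha>:]"
    using u(1) linear_polyE[of u] by auto
  then have \<alpha>: "\<alpha> \<noteq> 0" using u(1) by auto
  have "\<exists>\<psi>. (\<forall>i. \<forall>D\<in>Der. D (coeff \<psi> i) = 0) \<and> f = pcompose \<psi> u" if f: "f \<in> P" for f
  proof (intro exI conjI allI ballI)
    define \<psi> where "\<psi> = pcompose f [:- \<beta> / \<alpha>, 1 / \<alpha>:]"
    have "pcompose [:- \<beta> / \<alpha>, 1 / \<alpha>:] u = [:0, 1:]"
      using \<alpha> by (simp add: ub pcompose_pCons)
    then show eq: "f = pcompose \<psi> u"
      by (simp add: \<psi>_def flip: pcompose_assoc)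
    fix i D assume D: "D \<in> Der"
    have "covariant D (pcompose p u) = pcompose (map_poly D p) u" for p
    proof (induction p)
      case 0
      then show ?case by (simp add: derivation_0[OF derivation_covariant[OF D]])
    next
      case (pCons a p)
      have "covariant D [:a:] = [:D a:]"
        by (simp add: covariant_def map_poly_pCons derivation_0[OF der[OF D]])
      then show ?case
        by (simp add: pcompose_pCons map_poly_pCons derivation_0[OF der[OF D]] cov[OF D] pCons.IH
            derivation_add[OF derivation_covariant[OF D]] derivation_mult[OF derivation_covariant[OF D]])
    qed
    then have "pcompose (map_poly D \<psi>) u = 0"
      using covariant_P[OF D f] eq by simp
    then have "map_poly D \<psi> = 0" using u(1) by (simp add: pcompose_eq_0_iff)
    then show "D (coeff \<psi> i) = 0"
      by (metis coeff_0 coeff_map_poly derivation_0[OF der[OF D]])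
  qed
  then show thesis using that u by blast
qed

end

context horizontal_subring
begin

text \<open>
  The intersection of \<open>E[T]\<close> with \<open>Frac R\<close> is \<open>E[v]\<close> for some \<open>v\<close>. With \<open>v\<close> as new variable the situation is
  birational; the relation \<open>parallel\<close> persists because the terms with \<open>D v\<close> that the chain rule produces on
  its two sides agree.
\<close>

theorem descent:
  obtains u b where "degree u > 0" "b \<in> P" "b \<noteq> 0" "b * u \<in> P"
    "\<And>f. f \<in> P \<Longrightarrow> \<exists>\<psi>. (\<forall>i. \<forall>D\<in>Der. D (coeff \<psi> i) = 0) \<and> f = pcompose \<psi> u"
proof -
  define N where "N = {c. \<exists>b\<in>R. b \<noteq> 0 \<and> c * b \<in> R}"
  have RN: "R \<subseteq> N"
  proof
    fix c assume "c \<in> R"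
    then show "c \<in> N" unfolding N_def using R_const[of 1] by (auto intro!: bexI[of _ 1] simp: one_pCons)
  qed
  interpret N: exact_division_closed N
  proof
    show "[:a:] \<in> N" for a using R_const RN by blast
  next
    fix f g assume "f \<in> N" "g \<in> N"
    then obtain b c where b: "b \<in> R" "b \<noteq> 0" "f * b \<in> R" and c: "c \<in> R" "c \<noteq> 0" "g * c \<in> R"
      unfolding N_def by blast
    have "(f - g) * (b * c) = (f * b) * c - (g * c) * b" by (simp add: algebra_simps)
    then have "(f - g) * (b * c) \<in> R" using b c by (simp add: R_mult poly_vs.span_diff)
    then show "f - g \<in> N" unfolding N_def using b c R_mult by (auto intro!: bexI[of _ "b * c"])
    have "(f * g) * (b * c) = (f * b) * (g * c)" by (simp add: algebra_simps)
    then have "(f * g) * (b * c) \<in> R" using R_mult[OF b(3) c(3)] by (simp only:)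
    then show "f * g \<in> N" unfolding N_def using b c R_mult by (auto intro!: bexI[of _ "b * c"])
  next
    fix f g assume "f \<in> N" "f \<noteq> 0" "f * g \<in> N"
    then obtain b c where b: "b \<in> R" "b \<noteq> 0" "f * b \<in> R" and c: "c \<in> R" "c \<noteq> 0" "f * g * c \<in> R"
      unfolding N_def by blast
    have "g * ((f * b) * c) = (f * g * c) * b" by (simp add: algebra_simps)
    then have "g * ((f * b) * c) \<in> R" using R_mult[OF c(3) b(1)] by (simp only:)
    then show "g \<in> N" unfolding N_def using b c \<open>f \<noteq> 0\<close> R_mult by (auto intro!: bexI[of _ "(f * b) * c"])
  qed
  have "t \<in> N" using t_in RN poly_vs.span_base by blast
  then obtain v where v: "v \<in> N" "degree v > 0" and gen: "\<And>f. f \<in> N \<Longrightarrow> \<exists>g. f = pcompose g v"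
    using N.generated_by_one_polynomial degree_t by blast
  define P' where "P' = {f. pcompose f v \<in> P}"
  have lift: "\<exists>f'\<in>P'. f = pcompose f' v" if "f \<in> P" for f
    using gen[of f] that RN poly_vs.span_base[of f P] by (auto simp: P'_def)
  obtain t' where t': "t' \<in> P'" "t = pcompose t' v" using lift[OF t_in] by blast
  have cN: "pcompose c v \<in> N" for c
    by (induction c) (auto simp: pcompose_pCons N.zero_in N.const_in v(1) intro!: N.add_in N.mult_in)
  have inj: "pcompose f v = pcompose g v \<longleftrightarrow> f = g" for f g :: "'e poly"
    using pcompose_eq_0_iff[of v "f - g"] v(2) by (auto simp: pcompose_diff)
  have P'R: "\<exists>f'\<in>poly_vs.span P'. f = pcompose f' v" if "f \<in> R" for f
    using that
  proof (induction rule: poly_vs.span_induct_alt)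
    case base
    then show ?case by (auto intro!: bexI[of _ 0] poly_vs.span_zero)
  next
    case (step c x y)
    obtain x' y' where "x' \<in> P'" "x = pcompose x' v" "y' \<in> poly_vs.span P'" "y = pcompose y' v"
      using lift[OF step(1)] step(2) by blast
    then show ?case
      by (intro bexI[of _ "smult c x' + y'"])
        (simp_all add: pcompose_add pcompose_smult poly_vs.span_add poly_vs.span_scale poly_vs.span_base)
  qed
  have chain: "map_poly D (pcompose f v) = pcompose (map_poly D f) v + pcompose (pderiv f) v * map_poly D v"
    if D: "D \<in> Der" for D f
  proof (induction f)
    case 0
    then show ?case by simp
  next
    case (pCons a f)
    then show ?case
      by (simp add: pcompose_pCons map_poly_pCons derivation_0[OF der[OF D]] pderiv_pCons
          derivation_add[OF derivation_map_poly[OF der[OF D]]]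
          derivation_mult[OF derivation_map_poly[OF der[OF D]]] pcompose_add algebra_simps)
  qed
  interpret P': birational_horizontal_subring P' Der t'
  proof
    show "CHAR('e) = 0" by (fact char)
    show "derivation D" if "D \<in> Der" for D by (fact der[OF that])
    show "[:a:] \<in> P'" if "\<And>D. D \<in> Der \<Longrightarrow> D a = 0" for a
      using const_in[OF that] by (simp add: P'_def)
    show "f - g \<in> P'" "f * g \<in> P'" if "f \<in> P'" "g \<in> P'" for f g
      using that by (auto simp: P'_def pcompose_diff pcompose_mult diff_in mult_in)
    show "t' \<in> P'" by (fact t'(1))
    show "degree t' > 0" using degree_t t'(2) by (cases "degree t' = 0") (auto simp: degree_pcompose)
    show "pderiv t' * map_poly D f = map_poly D t' * pderiv f" if D: "D \<in> Der" and f: "f \<in> P'" for D f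
    proof -
      have "pderiv t * map_poly D (pcompose f v) = map_poly D t * pderiv (pcompose f v)"
        using parallel[OF D] f by (simp add: P'_def)
      then have "pderiv v * pcompose (pderiv t' * map_poly D f) v = pderiv v * pcompose (map_poly D t' * pderiv f) v"
        by (simp add: t'(2) chain[OF D] pderiv_pcompose pcompose_mult algebra_simps)
      then show ?thesis
        using pderiv_nonzero_char_0[OF char v(2)] by (simp add: inj)
    qed
    show "\<exists>b\<in>poly_vs.span P'. b \<noteq> 0 \<and> c * b \<in> poly_vs.span P'" for c
    proof -
      obtain b where b: "b \<in> R" "b \<noteq> 0" "pcompose c v * b \<in> R" using cN[of c] unfolding N_def by blast
      obtain b' c' where b': "b' \<in> poly_vs.span P'" "b = pcompose b' v"
        and c': "c' \<in> poly_vs.span P'" "pcompose c v * b = pcompose c' v"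
        using P'R b by metis
      have "c * b' = c'" using c'(2) by (simp add: b'(2) inj flip: pcompose_mult)
      then show ?thesis using b' c' b(2) by (intro bexI[of _ b']) auto
    qed
  qed
  obtain u b where u: "degree u = 1" "b \<in> P'" "b \<noteq> 0" "b * u \<in> P'"
    and horiz: "\<And>f. f \<in> P' \<Longrightarrow> \<exists>\<psi>. (\<forall>i. \<forall>D\<in>Der. D (coeff \<psi> i) = 0) \<and> f = pcompose \<psi> u"
    by (rule P'.birational_descent) blast
  show thesis
  proof (rule that[of "pcompose u v" "pcompose b v"])
    show "degree (pcompose u v) > 0" using u(1) v(2) by (simp add: degree_pcompose)
    show "pcompose b v \<in> P" "pcompose b v * pcompose u v \<in> P"
      using u by (simp_all add: P'_def pcompose_mult)
    show "pcompose b v \<noteq> 0" using u(3) v(2) by (simp add: pcompose_eq_0_iff)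
    show "\<exists>\<psi>. (\<forall>i. \<forall>D\<in>Der. D (coeff \<psi> i) = 0) \<and> f = pcompose \<psi> (pcompose u v)" if f: "f \<in> P" for f
    proof -
      obtain f' where "f' \<in> P'" "f = pcompose f' v" using lift[OF f] by blast
      then show ?thesis using horiz[of f'] by (metis pcompose_assoc)
    qed
  qed
qed

end

section \<open>Algebraic elements and derivations\<close>

lemma subring_closed:
  assumes "is_subring A"
  shows subring_1: "1 \<in> A" and subring_diff: "x \<in> A \<Longrightarrow> y \<in> A \<Longrightarrow> x - y \<in> A"
    and subring_mult: "x \<in> A \<Longrightarrow> y \<in> A \<Longrightarrow> x * y \<in> A"
  using assms by (auto simp: is_subring_def)

lemma subring_0: "is_subring A \<Longrightarrow> 0 \<in> A"
  using subring_diff[of A 1 1] by (simp add: subring_1)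

lemma subring_uminus: "is_subring A \<Longrightarrow> x \<in> A \<Longrightarrow> - x \<in> A"
  using subring_diff[of A 0 x] by (simp add: subring_0)

lemma subring_add: "is_subring A \<Longrightarrow> x \<in> A \<Longrightarrow> y \<in> A \<Longrightarrow> x + y \<in> A"
  using subring_diff[of A x "- y"] by (simp add: subring_uminus)

lemma subring_of_nat: "is_subring A \<Longrightarrow> of_nat n \<in> A"
  by (induction n) (auto simp: subring_0 subring_add subring_1)

lemma subring_power: "is_subring A \<Longrightarrow> x \<in> A \<Longrightarrow> x ^ n \<in> A"
  by (induction n) (auto simp: subring_1 subring_mult)

lemma subring_poly: "is_subring A \<Longrightarrow> (\<And>i. coeff p i \<in> A) \<Longrightarrow> x \<in> A \<Longrightarrow> poly p x \<in> A"
proof (induction p)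
  case (pCons a p)
  have "a \<in> A" "\<And>i. coeff p i \<in> A"
    using pCons.prems(2)[of 0] pCons.prems(2)[of "Suc _"] by auto
  then show ?case using pCons by (auto intro!: subring_add subring_mult)
qed (auto simp: subring_0)

lemma subfield_subring: "is_subfield K \<Longrightarrow> is_subring K"
  by (simp add: is_subfield_def)

lemma subfield_divide: "is_subfield K \<Longrightarrow> x \<in> K \<Longrightarrow> y \<in> K \<Longrightarrow> x / y \<in> K"
  by (simp add: is_subfield_def divide_inverse subring_mult)

lemma is_subfield_hull: "is_subfield (is_subfield hull S)"
  by (rule hull_in) (fastforce simp: is_subfield_def is_subring_def)

text \<open>
  If \<open>p\<close> is an equation of least degree for \<open>x\<close>, then \<open>0 = \<delta> (p(x)) = \<theta> (p'(x)) \<delta> x\<close>, and \<open>p'(x) \<noteq> 0\<close> by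
  minimality.
\<close>

lemma derivation_vanishes_on_algebraic:
  fixes \<theta> \<delta> :: "'a::idom \<Rightarrow> 'b::idom"
  assumes \<theta>: "is_ring_hom \<theta>" and \<delta>: "derivation_along \<theta> \<delta>"
    and inj: "\<And>x. \<theta> x = 0 \<Longrightarrow> x = 0" and char: "CHAR('a) = 0"
    and A: "is_subring A" and \<delta>A: "\<And>a. a \<in> A \<Longrightarrow> \<delta> a = 0" and alg: "algebraic_over A x"
  shows "\<delta> x = 0"
proof -
  let ?Q = "\<lambda>p. p \<noteq> 0 \<and> (\<forall>i. coeff p i \<in> A) \<and> poly p x = 0"
  define p where "p = arg_min degree ?Q"
  obtain p0 where "?Q p0" using alg unfolding algebraic_over_def by blast
  then have p: "?Q p" and min: "\<And>q. ?Q q \<Longrightarrow> degree p \<le> degree q"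
    using arg_min_nat_lemma[of ?Q p0 degree] unfolding p_def by blast+
  have deg: "degree p > 0"
  proof (rule ccontr)
    assume "\<not> degree p > 0"
    then obtain c where "p = [:c:]" using degree_eq_zeroE by auto
    then show False using p by auto
  qed
  have "poly (pderiv p) x \<noteq> 0"
  proof
    assume "poly (pderiv p) x = 0"
    moreover have "coeff (pderiv p) i \<in> A" for i
      unfolding coeff_pderiv using p by (intro subring_mult[OF A] subring_of_nat[OF A]) auto
    ultimately have "degree p \<le> degree (pderiv p)"
      using pderiv_nonzero_char_0[OF char deg] by (intro min) auto
    then show False using deg by (simp add: degree_pderiv_char_0[OF char])
  qed
  moreover have "map_poly \<delta> p = 0"
    using p \<delta>A by (intro poly_eqI) (simp add: coeff_map_poly along_0[OF \<theta> \<delta>])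
  then have "\<theta> (poly (pderiv p) x) * \<delta> x = 0"
    using along_poly[OF \<theta> \<delta>, of p x] p by (simp add: along_0[OF \<theta> \<delta>])
  ultimately show ?thesis using inj by auto
qed

lemma is_subfield_constants:
  fixes \<theta> \<delta> :: "'a::field \<Rightarrow> 'b::idom"
  assumes \<theta>: "is_ring_hom \<theta>" and \<delta>: "derivation_along \<theta> \<delta>" and inj: "\<And>x. \<theta> x = 0 \<Longrightarrow> x = 0"
  shows "is_subfield {x. \<delta> x = 0}"
proof -
  have "\<delta> (inverse x) = 0" if "\<delta> x = 0" for x
  proof (cases "x = 0")
    case False
    then have "\<theta> x * \<delta> (inverse x) = 0"
      using along_mult[OF \<theta> \<delta>, of x "inverse x"] that by (simp add: along_1[OF \<theta> \<delta>])
    then show ?thesis using inj[of x] False by auto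
  qed (simp add: along_0[OF \<theta> \<delta>])
  then show ?thesis
    by (auto simp: is_subfield_def is_subring_def along_1[OF \<theta> \<delta>] along_diff[OF \<theta> \<delta>] along_mult[OF \<theta> \<delta>])
qed

lemma clear_denominators:
  fixes h :: "'a::comm_ring_1 \<Rightarrow> 'e::field"
  assumes h: "is_ring_hom h" and A: "is_subring A" and S: "S \<subseteq> A" "1 \<in> S"
    and S_mult: "\<And>b c. b \<in> S \<Longrightarrow> c \<in> S \<Longrightarrow> b * c \<in> S"
    and frac: "\<And>i. \<exists>a\<in>A. \<exists>b\<in>S. h b * coeff p i = h a"
  shows "\<exists>d\<in>S. \<exists>q. (\<forall>i. coeff q i \<in> A) \<and> map_poly h q = smult (h d) p"
  using frac
proof (induction p)
  case 0
  show ?case using S subring_0[OF A] by (intro bexI[of _ 1] exI[of _ 0]) auto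
next
  case (pCons c p)
  have "\<exists>a\<in>A. \<exists>b\<in>S. h b * coeff p i = h a" for i
    using pCons.prems[of "Suc i"] by simp
  then obtain d q where dq: "d \<in> S" "\<forall>i. coeff q i \<in> A" "map_poly h q = smult (h d) p"
    using pCons.IH by blast
  obtain a b where ab: "a \<in> A" "b \<in> S" "h b * c = h a" using pCons.prems[of 0] by auto
  show ?case
  proof (intro bexI[of _ "b * d"] exI[of _ "pCons (a * d) (smult b q)"] conjI allI)
    show "coeff (pCons (a * d) (smult b q)) i \<in> A" for i
      using ab dq S(1) by (cases i) (auto intro!: subring_mult[OF A])
    have "map_poly h (smult b q) = smult (h b) (map_poly h q)"
      by (intro poly_eqI) (simp add: coeff_map_poly ring_hom_0[OF h] ring_hom_mult[OF h])
    then show "map_poly h (pCons (a * d) (smult b q)) = smult (h (b * d)) (pCons c p)"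
      using dq(3) ab(3)
      by (simp add: map_poly_pCons ring_hom_0[OF h] ring_hom_mult[OF h] mult_ac flip: ab(3))
  qed (use ab dq S_mult in auto)
qed

lemma is_subring_polys_over: "is_subring K \<Longrightarrow> is_subring {p. \<forall>i. coeff p i \<in> K}"
proof -
  assume K: "is_subring K"
  have "coeff (p * q) i \<in> K" if "\<forall>i. coeff p i \<in> K" "\<forall>i. coeff q i \<in> K" for p q i
  proof -
    have "sum f I \<in> K" if "\<And>x. x \<in> I \<Longrightarrow> f x \<in> K" for f and I :: "nat set"
      using that by (induction I rule: infinite_finite_induct) (auto simp: subring_0[OF K] subring_add[OF K])
    from this[of "{..i}" "\<lambda>j. coeff p j * coeff q (i - j)"] show ?thesis
      unfolding coeff_mult using that by (simp add: subring_mult[OF K])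
  qed
  then show ?thesis
    using K by (auto simp: is_subring_def subring_0[OF K] coeff_1 intro: subring_1)
qed

lemma simple_extension_fractions:
  assumes K: "is_subfield (K :: 'e::field set)" and x: "x \<in> is_subfield hull (K \<union> {z})"
  shows "\<exists>p q. (\<forall>i. coeff p i \<in> K) \<and> (\<forall>i. coeff q i \<in> K) \<and> poly q z \<noteq> 0 \<and> x = poly p z / poly q z"
proof -
  define KZ where "KZ = {p. \<forall>i. coeff p i \<in> K}"
  have KZ: "is_subring KZ" unfolding KZ_def by (rule is_subring_polys_over[OF subfield_subring[OF K]])
  have KZI: "[:a:] \<in> KZ" if "a \<in> K" for a
    using that subring_0[OF subfield_subring[OF K]] by (auto simp: KZ_def coeff_pCons split: nat.splits)
  define F where "F = {poly p z / poly q z | p q. p \<in> KZ \<and> q \<in> KZ \<and> poly q z \<noteq> 0}"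
  have F: "poly p z / poly q z \<in> F" if "p \<in> KZ" "q \<in> KZ" "poly q z \<noteq> 0" for p q
    using that by (auto simp: F_def)
  have "is_subfield F"
    unfolding is_subfield_def is_subring_def
  proof (intro conjI ballI)
    show "1 \<in> F" using F[OF subring_1[OF KZ] subring_1[OF KZ]] by simp
  next
    fix x y assume "x \<in> F" "y \<in> F"
    then obtain p q r s where x: "p \<in> KZ" "q \<in> KZ" "poly q z \<noteq> 0" "x = poly p z / poly q z"
      and y: "r \<in> KZ" "s \<in> KZ" "poly s z \<noteq> 0" "y = poly r z / poly s z"
      unfolding F_def by auto
    have "x - y = poly (p * s - r * q) z / poly (q * s) z"
      using x(3) y(3) by (simp add: x(4) y(4) diff_frac_eq)
    also have "\<dots> \<in> F"
      using x y by (intro F subring_diff[OF KZ] subring_mult[OF KZ]) auto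
    finally show "x - y \<in> F" .
    have "x * y = poly (p * r) z / poly (q * s) z"
      using x y by simp
    also have "\<dots> \<in> F"
      using x y by (intro F subring_mult[OF KZ]) auto
    finally show "x * y \<in> F" .
  next
    fix x assume "x \<in> F"
    then obtain p q where x: "p \<in> KZ" "q \<in> KZ" "poly q z \<noteq> 0" "x = poly p z / poly q z"
      unfolding F_def by auto
    show "inverse x \<in> F"
    proof (cases "poly p z = 0")
      case True
      then show ?thesis using F[OF subring_0[OF KZ] subring_1[OF KZ]] x by simp
    next
      case False
      then show ?thesis using F[of q p] x by simp
    qed
  qed
  moreover have "K \<union> {z} \<subseteq> F"
  proof
    fix y assume "y \<in> K \<union> {z}"
    moreover have "z \<in> F"
      using F[OF _ subring_1[OF KZ], of "[:0, 1:]"] subring_0[OF subfield_subring[OF K]]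
        subring_1[OF subfield_subring[OF K]]
      by (auto simp: KZ_def coeff_pCons split: nat.splits)
    moreover have "a \<in> F" if "a \<in> K" for a
      using F[OF KZI[OF that] subring_1[OF KZ]] by simp
    ultimately show "y \<in> F" by auto
  qed
  ultimately have "x \<in> F" using x hull_minimal[of "K \<union> {z}" F is_subfield] by blast
  then show ?thesis by (auto simp: F_def KZ_def)
qed

text \<open>
  After clearing denominators, an equation for \<open>t\<close> over \<open>K(z)\<close> is a polynomial relation between \<open>t\<close> and \<open>z\<close>.
  Read as a polynomial in \<open>z\<close> it is nontrivial because \<open>t\<close> is transcendental.
\<close>

lemma algebraic_exchange:
  assumes K: "is_subfield (K :: 'e::field set)"
    and t: "algebraic_over (is_subfield hull (K \<union> {z})) t" "\<not> algebraic_over K t"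
  shows "algebraic_over (is_subfield hull (K \<union> {t})) z"
proof -
  define KZ where "KZ = {p. \<forall>i. coeff p i \<in> K}"
  have KZ: "is_subring KZ" unfolding KZ_def by (rule is_subring_polys_over[OF subfield_subring[OF K]])
  let ?S = "{p \<in> KZ. poly p z \<noteq> 0}"
  obtain p where p: "p \<noteq> 0" "\<And>i. coeff p i \<in> is_subfield hull (K \<union> {z})" "poly p t = 0"
    using t(1) unfolding algebraic_over_def by blast
  have "\<exists>a\<in>KZ. \<exists>b\<in>?S. poly b z * coeff p i = poly a z" for i
  proof -
    obtain a b where "a \<in> KZ" "b \<in> KZ" "poly b z \<noteq> 0" "coeff p i = poly a z / poly b z"
      using simple_extension_fractions[OF K p(2)[of i]] unfolding KZ_def by blast
    then show ?thesis by (intro bexI[of _ a] bexI[of _ b]) auto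
  qed
  then obtain d q where d: "d \<in> ?S" and q: "\<forall>i. coeff q i \<in> KZ" "map_poly (\<lambda>c. poly c z) q = smult (poly d z) p"
    using clear_denominators[OF is_ring_hom_poly KZ, of ?S z p] subring_1[OF KZ] subring_mult[OF KZ] by auto
  define r where "r = poly q [:t:]"
  have coeff_r: "coeff r i = poly (map_poly (\<lambda>c. coeff c i) q) t" for i
    unfolding r_def by (induction q) (auto simp: map_poly_pCons)
  have "poly r z = poly (map_poly (\<lambda>c. poly c z) q) t"
    using ring_hom_poly[OF is_ring_hom_poly, of q "[:t:]" z] by (simp add: r_def)
  then have "poly r z = 0" by (simp add: q(2) p(3))
  moreover have "r \<noteq> 0"
  proof
    assume "r = 0"
    then have "poly (map_poly (\<lambda>c. coeff c i) q) t = 0" for i using coeff_r[of i] by simp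
    moreover have "coeff (map_poly (\<lambda>c. coeff c i) q) j \<in> K" for i j
      using q(1) by (auto simp: coeff_map_poly KZ_def)
    ultimately have "map_poly (\<lambda>c. coeff c i) q = 0" for i
      using t(2) unfolding algebraic_over_def by blast
    then have "coeff (coeff q j) i = 0" for i j
      by (metis coeff_0 coeff_map_poly)
    then have "q = 0" by (intro poly_eqI) simp
    then show False using q(2) d p(1) by simp
  qed
  moreover have "coeff r i \<in> is_subfield hull (K \<union> {t})" for i
    unfolding coeff_r
  proof (rule subring_poly[OF subfield_subring[OF is_subfield_hull]])
    show "t \<in> is_subfield hull (K \<union> {t})" by (simp add: hull_inc)
    show "coeff (map_poly (\<lambda>c. coeff c i) q) j \<in> is_subfield hull (K \<union> {t})" for j
      using q(1) by (auto simp: coeff_map_poly KZ_def intro!: hull_inc)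
  qed
  ultimately show ?thesis unfolding algebraic_over_def by blast
qed

text \<open>
  By exchange the generator \<open>z\<close> is algebraic over \<open>K(t)\<close>, where \<open>\<delta>\<close> vanishes. So \<open>\<delta>\<close> vanishes on \<open>K(z)\<close>
  and then on all elements algebraic over it.
\<close>

lemma derivation_vanishes_in_trdeg_1:
  fixes \<theta> \<delta> :: "'a::field \<Rightarrow> 'b::idom"
  assumes \<theta>: "is_ring_hom \<theta>" and \<delta>: "derivation_along \<theta> \<delta>"
    and inj: "\<And>x. \<theta> x = 0 \<Longrightarrow> x = 0" and char: "CHAR('a) = 0"
    and K: "is_subfield K" and \<delta>K: "\<And>a. a \<in> K \<Longrightarrow> \<delta> a = 0"
    and t: "t \<in> L" "\<not> algebraic_over K t" "\<delta> t = 0"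
    and L: "\<And>y. y \<in> L \<Longrightarrow> algebraic_over (is_subfield hull (K \<union> {z})) y"
    and y: "y \<in> L"
  shows "\<delta> y = 0"
proof -
  have hull: "\<delta> a = 0" if "\<delta> x = 0" "a \<in> is_subfield hull (K \<union> {x})" for x a
  proof -
    have "is_subfield hull (K \<union> {x}) \<subseteq> {x. \<delta> x = 0}"
      using \<delta>K that by (intro hull_minimal is_subfield_constants[OF \<theta> \<delta> inj]) auto
    then show ?thesis using that by auto
  qed
  note vanish = derivation_vanishes_on_algebraic[OF \<theta> \<delta> inj char subfield_subring[OF is_subfield_hull] hull]
  have "\<delta> z = 0"
    using vanish[OF _ t(3) _ algebraic_exchange[OF K L[OF t(1)] t(2)]] by simp
  then show ?thesis using vanish[OF _ _ _ L[OF y]] by simp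
qed

section \<open>Fraction fields\<close>

text \<open>
  Polynomials over \<open>'b fract\<close> form a factorial ring with greatest common divisors. For the type classes to
  know this, the coefficients must belong to \<open>field_gcd\<close>, with the trivial Euclidean structure of a field.
\<close>

instantiation fract :: (idom)
  "{unique_euclidean_ring, normalization_euclidean_semiring, normalization_semidom_multiplicative}"
begin

definition [simp]: "normalize_fract = (normalize_field :: 'a fract \<Rightarrow> _)"
definition [simp]: "unit_factor_fract = (unit_factor_field :: 'a fract \<Rightarrow> _)"
definition [simp]: "modulo_fract = (mod_field :: 'a fract \<Rightarrow> _)"
definition [simp]: "euclidean_size_fract = (euclidean_size_field :: 'a fract \<Rightarrow> _)"
definition [simp]: "division_segment (x :: 'a fract) = 1"

instance
  by standard
    (simp_all add: dvd_field_iff field_split_simps split: if_splits)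

end

instantiation fract :: (idom) euclidean_ring_gcd
begin

definition gcd_fract :: "'a fract \<Rightarrow> 'a fract \<Rightarrow> 'a fract" where
  "gcd_fract = Euclidean_Algorithm.gcd"
definition lcm_fract :: "'a fract \<Rightarrow> 'a fract \<Rightarrow> 'a fract" where
  "lcm_fract = Euclidean_Algorithm.lcm"
definition Gcd_fract :: "'a fract set \<Rightarrow> 'a fract" where
 "Gcd_fract = Euclidean_Algorithm.Gcd"
definition Lcm_fract :: "'a fract set \<Rightarrow> 'a fract" where
 "Lcm_fract = Euclidean_Algorithm.Lcm"

instance by standard (simp_all add: gcd_fract_def lcm_fract_def Gcd_fract_def Lcm_fract_def)

end

instance fract :: (idom) field_gcd ..

lemma is_ring_hom_to_fract: "is_ring_hom to_fract"
  by (simp add: is_ring_hom_def)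

lemma to_fract_power: "to_fract (x ^ n) = to_fract x ^ n"
  by (induction n) auto

lemma CHAR_fract: "CHAR('b::idom) = 0 \<Longrightarrow> CHAR('b fract) = 0"
proof -
  assume char: "CHAR('b) = 0"
  have "of_nat n \<noteq> (0 :: 'b fract)" if "n > 0" for n
  proof -
    have "of_nat n = to_fract (of_nat n :: 'b)" by (simp add: ring_hom_of_nat[OF is_ring_hom_to_fract])
    then show ?thesis using char that by (simp add: of_nat_eq_0_iff_char_dvd)
  qed
  then show ?thesis by (simp add: CHAR_eq0_iff)
qed

lemma fract_obtain:
  obtains a b where "b \<noteq> 0" "x = to_fract a / to_fract b"
  by (cases x) (auto simp: Fract_conv_to_fract)

lemma localization_iff:
  "x \<in> localization S A \<longleftrightarrow> (\<exists>a\<in>A. \<exists>s\<in>S. x = to_fract a / to_fract s)"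
  by (auto simp: localization_def Fract_conv_to_fract)

lemma frac_field_iff:
  "x \<in> frac_field A \<longleftrightarrow> (\<exists>a\<in>A. \<exists>b\<in>A. b \<noteq> 0 \<and> x = to_fract a / to_fract b)"
  by (auto simp: frac_field_def localization_iff)

lemma to_fract_in_frac_field: "is_subring A \<Longrightarrow> a \<in> A \<Longrightarrow> to_fract a \<in> frac_field A"
  unfolding frac_field_iff by (intro bexI[of _ a] bexI[of _ 1]) (auto simp: subring_1)

lemma is_subring_localization:
  assumes A: "is_subring A" and S: "S \<subseteq> A" "1 \<in> S" "0 \<notin> S"
    and S_mult: "\<And>b c. b \<in> S \<Longrightarrow> c \<in> S \<Longrightarrow> b * c \<in> S"
  shows "is_subring (localization S A)"
  unfolding is_subring_def
proof (intro conjI ballI)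
  show "1 \<in> localization S A"
    unfolding localization_iff using S A by (intro bexI[of _ 1]) (auto simp: subring_1)
  fix x y assume "x \<in> localization S A" "y \<in> localization S A"
  then obtain a s b t where x: "a \<in> A" "s \<in> S" "x = to_fract a / to_fract s"
    and y: "b \<in> A" "t \<in> S" "y = to_fract b / to_fract t"
    unfolding localization_iff by blast
  have "to_fract s \<noteq> 0" "to_fract t \<noteq> 0" using x y S by auto
  then have "x - y = to_fract (a * t - b * s) / to_fract (s * t)"
    by (simp add: x(3) y(3) diff_frac_eq)
  moreover have "a * t - b * s \<in> A" "s * t \<in> S"
    using x y S S_mult by (auto intro!: subring_diff[OF A] subring_mult[OF A])
  ultimately show "x - y \<in> localization S A" unfolding localization_iff by blast
  have "x * y = to_fract (a * b) / to_fract (s * t)" by (simp add: x y)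
  moreover have "a * b \<in> A" "s * t \<in> S"
    using x y S_mult by (auto intro!: subring_mult[OF A])
  ultimately show "x * y \<in> localization S A" unfolding localization_iff by blast
qed

lemma localization_clear_denominators:
  assumes A: "is_subring A" and R: "is_subring R" "R \<subseteq> A"
    and p: "\<And>i. coeff p i \<in> localization (R - {0}) A"
  obtains d q where "d \<in> R" "d \<noteq> 0" "\<And>i. coeff q i \<in> A" "fract_poly q = smult (to_fract d) p"
proof -
  have "\<exists>a\<in>A. \<exists>b\<in>R - {0}. to_fract b * coeff p i = to_fract a" for i
  proof -
    obtain a b where "a \<in> A" "b \<in> R - {0}" "coeff p i = to_fract a / to_fract b"
      using p[of i] unfolding localization_iff by blast
    then show ?thesis by (intro bexI[of _ a] bexI[of _ b]) auto
  qed
  then have "\<exists>d\<in>R - {0}. \<exists>q. (\<forall>i. coeff q i \<in> A) \<and> fract_poly q = smult (to_fract d) p"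
    using R by (intro clear_denominators is_ring_hom_to_fract A) (auto simp: subring_1 subring_mult)
  then show thesis using that by blast
qed

lemma is_subfield_frac_field:
  assumes A: "is_subring A"
  shows "is_subfield (frac_field A)"
  unfolding is_subfield_def
proof
  show "is_subring (frac_field A)"
    unfolding frac_field_def using A
    by (intro is_subring_localization) (auto simp: subring_1 subring_mult)
  show "\<forall>x\<in>frac_field A. inverse x \<in> frac_field A"
  proof
    fix x assume "x \<in> frac_field A"
    then obtain a b where ab: "a \<in> A" "b \<in> A" "b \<noteq> 0" "x = to_fract a / to_fract b"
      unfolding frac_field_iff by blast
    show "inverse x \<in> frac_field A"
    proof (cases "a = 0")
      case True
      then show ?thesis using ab to_fract_in_frac_field[OF A subring_0[OF A]] by simp
    next
      case False
      then have "inverse x = to_fract b / to_fract a" by (simp add: ab)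
      then show ?thesis unfolding frac_field_iff using ab False by blast
    qed
  qed
qed

lemma localization_of_subring:
  assumes R: "is_subring R" "R \<subseteq> A"
  shows frac_field_subset_localization: "frac_field R \<subseteq> localization (R - {0}) A"
    and localization_subset_frac_field: "localization (R - {0}) A \<subseteq> frac_field A"
    and to_fract_in_localization: "a \<in> A \<Longrightarrow> to_fract a \<in> localization (R - {0}) A"
    and subring_localization: "is_subring A \<Longrightarrow> is_subring (localization (R - {0}) A)"
proof -
  show "frac_field R \<subseteq> localization (R - {0}) A"
    unfolding frac_field_def localization_iff subset_iff using R(2) by blast
  show "localization (R - {0}) A \<subseteq> frac_field A"
    unfolding frac_field_def localization_iff subset_iff using R(2) by blast
  show "to_fract a \<in> localization (R - {0}) A" if "a \<in> A"
    unfolding localization_iff using that R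
    by (intro bexI[of _ a] bexI[of _ 1]) (auto simp: subring_1)
  show "is_subring (localization (R - {0}) A)" if "is_subring A"
    using R that by (intro is_subring_localization) (auto simp: subring_1 subring_mult)
qed

lemma frac_field_mono: "A \<subseteq> B \<Longrightarrow> frac_field A \<subseteq> frac_field B"
  by (rule subsetI) (unfold frac_field_iff, blast)

text \<open>
  Multiplying an equation of degree \<open>m\<close> by \<open>s ^ m\<close> gives a monic equation for \<open>s x\<close> with coefficients
  \<open>s ^ (m - i) c\<^sub>i\<close>, which lie in the domain.
\<close>

lemma normal_domain_integral:
  fixes x :: "'b::idom fract"
  assumes normal: "normal_domain (UNIV :: 'b set)"
    and p: "lead_coeff p = 1" "poly p x = 0"
    and s: "\<And>i. to_fract s * coeff p i \<in> range to_fract"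
  shows "to_fract s * x \<in> range to_fract"
proof (cases "s = 0")
  case True
  then show ?thesis by (metis mult_zero_left rangeI to_fract_0)
next
  case False
  define m where "m = degree p"
  define q where "q = (\<Sum>i\<le>m. monom (to_fract s ^ (m - i) * coeff p i) i)"
  have coeff_q: "coeff q i = (if i \<le> m then to_fract s ^ (m - i) * coeff p i else 0)" for i
    by (simp add: q_def coeff_sum)
  have "poly q (to_fract s * x) = (\<Sum>i\<le>m. to_fract s ^ m * (coeff p i * x ^ i))"
    unfolding q_def poly_sum poly_monom
  proof (intro sum.cong refl)
    fix i assume "i \<in> {..m}"
    then have "to_fract s ^ m = to_fract s ^ (m - i) * to_fract s ^ i"
      by (simp flip: power_add)
    then show "to_fract s ^ (m - i) * coeff p i * (to_fract s * x) ^ i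
      = to_fract s ^ m * (coeff p i * x ^ i)"
      by (simp add: power_mult_distrib mult_ac)
  qed
  also have "\<dots> = to_fract s ^ m * poly p x"
    by (simp add: poly_altdef m_def sum_distrib_left)
  finally have root: "poly q (to_fract s * x) = 0" using p by simp
  have qm: "coeff q m = 1" using p by (simp add: coeff_q m_def)
  have "degree q \<le> m" by (rule degree_le) (simp add: coeff_q)
  then have "degree q = m" using qm le_degree[of q m] by simp
  then have lead: "lead_coeff q = 1" using qm by simp
  have "coeff q i \<in> range to_fract" for i
  proof (cases "i < m")
    case True
    then have "coeff q i = to_fract (s ^ (m - Suc i)) * (to_fract s * coeff p i)"
      by (simp add: coeff_q to_fract_power Suc_diff_Suc flip: power_Suc2 mult.assoc)
    then show ?thesis using s[of i] by (auto simp flip: to_fract_mult)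
  next
    case False
    then show ?thesis using qm coeff_q[of i] by (cases "i = m") (auto intro: rangeI[of to_fract 0, simplified] rangeI[of to_fract 1, simplified])
  qed
  moreover have "to_fract s * x \<in> frac_field (UNIV :: 'b set)"
    by (rule fract_obtain[of "to_fract s * x"]) (auto simp: frac_field_iff)
  ultimately show ?thesis
    using normal lead root unfolding normal_domain_def by blast
qed

section \<open>Locally nilpotent derivations and their extensions to the fraction field\<close>

text \<open>
  The quotient rule, in the form \<open>(D a - x D b) / b\<close> for \<open>x = a / b\<close>. A representation of \<open>x\<close> is chosen
  because the value is independent of it only if \<open>D\<close> is a derivation.
\<close>

definition frac_deriv :: "('b::idom \<Rightarrow> 'b) \<Rightarrow> 'b fract \<Rightarrow> 'b fract" where
  "frac_deriv D x =
    (let (a, b) = (SOME (a, b). b \<noteq> 0 \<and> x = to_fract a / to_fract b)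
     in (to_fract (D a) - x * to_fract (D b)) / to_fract b)"

context
  fixes D :: "'b::idom \<Rightarrow> 'b"
  assumes D: "derivation D"
begin

lemma frac_deriv_eq:
  assumes b: "b \<noteq> 0" and x: "x * to_fract b = to_fract a"
  shows "frac_deriv D x * to_fract b = to_fract (D a) - x * to_fract (D b)"
proof -
  define c d where "c = fst (SOME (a, b). b \<noteq> 0 \<and> x = to_fract a / to_fract b)"
    and "d = snd (SOME (a, b). b \<noteq> 0 \<and> x = to_fract a / to_fract b)"
  have "case (SOME (a, b). b \<noteq> 0 \<and> x = to_fract a / to_fract b) of
      (a, b) \<Rightarrow> b \<noteq> 0 \<and> x = to_fract a / to_fract b"
    by (rule someI[of _ "(a, b)"]) (use b x in \<open>auto simp: field_simps\<close>)
  then have d: "d \<noteq> 0" "x * to_fract d = to_fract c"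
    by (auto simp: c_def d_def split: prod.splits)
  have fd: "frac_deriv D x = (to_fract (D c) - x * to_fract (D d)) / to_fract d"
    by (simp add: frac_deriv_def c_def d_def split: prod.splits)
  have "to_fract (a * d) = to_fract (c * b)" by (simp flip: x d(2))
  then have "D (a * d) = D (c * b)" by (simp only: to_fract_eq_iff)
  then have "to_fract (D a * d + a * D d) = to_fract (D c * b + c * D b)"
    by (simp only: derivation_mult[OF D])
  then have "to_fract (D a) * to_fract d + x * to_fract b * to_fract (D d)
      = to_fract (D c) * to_fract b + x * to_fract d * to_fract (D b)"
    by (simp add: x d(2))
  then show ?thesis using d(1) by (simp add: fd field_simps)
qed

lemma frac_deriv_to_fract: "frac_deriv D (to_fract a) = to_fract (D a)"
  using frac_deriv_eq[of 1 "to_fract a" a] by (simp add: derivation_1[OF D])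

lemma derivation_frac_deriv: "derivation (frac_deriv D)"
  unfolding derivation_def
proof (intro conjI allI)
  fix x y :: "'b fract"
  obtain a b where b: "b \<noteq> 0" "x = to_fract a / to_fract b" by (rule fract_obtain)
  obtain c d where d: "d \<noteq> 0" "y = to_fract c / to_fract d" by (rule fract_obtain)
  have x: "x * to_fract b = to_fract a" and y: "y * to_fract d = to_fract c" using b d by auto
  note fx = frac_deriv_eq[OF b(1) x] and fy = frac_deriv_eq[OF d(1) y]
  have bd: "b * d \<noteq> 0" "to_fract (b * d) \<noteq> 0" using b d by auto
  have "(x + y) * to_fract (b * d) = to_fract (a * d + c * b)"
    by (simp flip: x y add: algebra_simps)
  from frac_deriv_eq[OF bd(1) this]
  have "frac_deriv D (x + y) * to_fract (b * d) =
      to_fract (D a) * to_fract d + (x * to_fract b) * to_fract (D d)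
      + to_fract (D c) * to_fract b + (y * to_fract d) * to_fract (D b)
      - (x + y) * (to_fract (D b) * to_fract d + to_fract b * to_fract (D d))"
    by (simp add: derivation_mult[OF D] derivation_add[OF D] x y algebra_simps)
  also have "\<dots> = (to_fract (D a) - x * to_fract (D b)) * to_fract d
      + (to_fract (D c) - y * to_fract (D d)) * to_fract b"
    by (simp add: algebra_simps)
  also have "\<dots> = (frac_deriv D x + frac_deriv D y) * to_fract (b * d)"
    by (simp flip: fx fy add: algebra_simps)
  finally show "frac_deriv D (x + y) = frac_deriv D x + frac_deriv D y"
    by (rule mult_right_cancel[THEN iffD1, OF bd(2)])
  have "(x * y) * to_fract (b * d) = to_fract (a * c)"
    by (simp flip: x y add: algebra_simps)
  from frac_deriv_eq[OF bd(1) this]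
  have "frac_deriv D (x * y) * to_fract (b * d) =
      to_fract (D a) * (y * to_fract d) + (x * to_fract b) * to_fract (D c)
      - (x * y) * (to_fract (D b) * to_fract d + to_fract b * to_fract (D d))"
    by (simp add: derivation_mult[OF D] x y algebra_simps)
  also have "\<dots> = (to_fract (D a) - x * to_fract (D b)) * to_fract d * y
      + (to_fract (D c) - y * to_fract (D d)) * to_fract b * x"
    by (simp add: algebra_simps)
  also have "\<dots> = (frac_deriv D x * y + x * frac_deriv D y) * to_fract (b * d)"
    by (simp flip: fx fy add: algebra_simps)
  finally show "frac_deriv D (x * y) = frac_deriv D x * y + x * frac_deriv D y"
    by (rule mult_right_cancel[THEN iffD1, OF bd(2)])
qed

end

lemma LND_derivation: "D \<in> LND \<Longrightarrow> derivation D"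
  by (simp add: LND_def)

text \<open>
  If \<open>x = a / b\<close> is a constant, then applying the derivation to \<open>x b = a\<close> gives \<open>x = (D\<^sup>n a) / (D\<^sup>n b)\<close> as
  long as \<open>D\<^sup>n b \<noteq> 0\<close>. For the last such \<open>n\<close> the denominator, and hence the numerator, is in \<open>ker D\<close>.
\<close>

lemma frac_field_ker:
  assumes D: "D \<in> LND"
  shows "frac_field (ker D) = {x. frac_deriv D x = 0}"
proof (intro set_eqI iffI)
  fix x assume "x \<in> frac_field (ker D)"
  then obtain a b where ab: "D a = 0" "D b = 0" "b \<noteq> 0" "x = to_fract a / to_fract b"
    by (auto simp: frac_field_iff ker_def)
  then have "frac_deriv D x * to_fract b = 0"
    using frac_deriv_eq[OF LND_derivation[OF D] ab(3), of x a] by simp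
  then show "x \<in> {x. frac_deriv D x = 0}" using ab by simp
next
  fix x assume "x \<in> {x. frac_deriv D x = 0}"
  then have dx: "frac_deriv D x = 0" by simp
  obtain a b where b: "b \<noteq> 0" "x = to_fract a / to_fract b" by (rule fract_obtain)
  note dD = LND_derivation[OF D]
  have iter: "x * to_fract ((D ^^ n) b) = to_fract ((D ^^ n) a)" for n
  proof (induction n)
    case (Suc n)
    have "frac_deriv D (x * to_fract ((D ^^ n) b)) = x * to_fract (D ((D ^^ n) b))"
      by (simp add: derivation_mult[OF derivation_frac_deriv[OF dD]] dx frac_deriv_to_fract[OF dD])
    then show ?case by (simp add: Suc frac_deriv_to_fract[OF dD])
  qed (use b in simp)
  define N where "N = (LEAST n. (D ^^ n) b = 0)"
  obtain n where "(D ^^ n) b = 0" using D by (auto simp: LND_def)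
  then have N: "(D ^^ N) b = 0" unfolding N_def by (rule LeastI)
  then obtain m where m: "N = Suc m" using b(1) by (cases N) auto
  have "(D ^^ m) b \<noteq> 0"
    using not_less_Least[of m "\<lambda>n. (D ^^ n) b = 0"] m by (auto simp flip: N_def)
  moreover have "(D ^^ m) b \<in> ker D" using N m by (simp add: ker_def)
  moreover have "to_fract ((D ^^ Suc m) a) = 0" using iter[of "Suc m"] N m by simp
  then have "(D ^^ m) a \<in> ker D" by (simp add: ker_def)
  moreover have "x = to_fract ((D ^^ m) a) / to_fract ((D ^^ m) b)"
    using iter[of m] calculation(1) by (simp add: field_simps)
  ultimately show "x \<in> frac_field (ker D)" unfolding frac_field_iff by blast
qed

lemma K_of_eq:
  assumes "\<Delta> \<subseteq> LND"
  shows "K_of \<Delta> = {x. \<forall>D\<in>\<Delta>. frac_deriv D x = 0}"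
proof -
  have "frac_field (ker D) = {x. frac_deriv D x = 0}" if "D \<in> \<Delta>" for D
    using frac_field_ker assms that by blast
  then show ?thesis unfolding K_of_def by auto
qed

lemma A_of_iff: "a \<in> A_of \<Delta> \<longleftrightarrow> (\<forall>D\<in>\<Delta>. D a = 0)"
  by (auto simp: A_of_def ker_def)

lemma is_subring_A_of:
  assumes "\<Delta> \<subseteq> LND"
  shows "is_subring (A_of \<Delta>)"
proof -
  have *: "is_subring (ker D)" if "D \<in> \<Delta>" for D
  proof -
    have "derivation D" using assms that by (auto intro: LND_derivation)
    then show ?thesis
      by (simp add: is_subring_def ker_def derivation_1 derivation_diff derivation_mult)
  qed
  show ?thesis
    unfolding A_of_def is_subring_def[of "\<Inter> _"]
    by (auto intro: subring_1[OF *] subring_diff[OF *] subring_mult[OF *])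
qed

lemma frac_deriv_vanishes_on_frac_A_of:
  assumes \<Delta>: "\<Delta> \<subseteq> LND" and D: "D \<in> \<Delta>" and x: "x \<in> frac_field (A_of \<Delta>)"
  shows "frac_deriv D x = 0"
proof -
  have "A_of \<Delta> \<subseteq> ker D" using D by (auto simp: A_of_def)
  then have "x \<in> frac_field (ker D)" using x frac_field_mono by blast
  then show ?thesis using frac_field_ker \<Delta> D by blast
qed

lemma A_of_frac:
  assumes \<Delta>: "\<Delta> \<subseteq> LND" and x: "to_fract b \<in> frac_field (A_of \<Delta>)"
  shows "b \<in> A_of \<Delta>"
  unfolding A_of_iff
proof
  fix D assume D: "D \<in> \<Delta>"
  then have "derivation D" using \<Delta> by (auto intro: LND_derivation)
  then have "to_fract (D b) = frac_deriv D (to_fract b)" by (simp add: frac_deriv_to_fract)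
  then show "D b = 0" using frac_deriv_vanishes_on_frac_A_of[OF \<Delta> D x] by simp
qed

lemma A_of_algebraically_closed:
  assumes \<Delta>: "\<Delta> \<subseteq> LND" and char: "CHAR('b::idom) = 0" and b: "algebraic_over (A_of \<Delta>) (b :: 'b)"
  shows "b \<in> A_of \<Delta>"
  unfolding A_of_iff
proof
  fix D assume D: "D \<in> \<Delta>"
  then have "derivation_along (\<lambda>x. x) D"
    using \<Delta> by (auto intro: LND_derivation simp flip: derivation_iff_along)
  then show "D b = 0"
    by (rule derivation_vanishes_on_algebraic[OF is_ring_hom_id _ _ char is_subring_A_of[OF \<Delta>] _ b])
      (use D in \<open>auto simp: A_of_iff\<close>)
qed

text \<open>
  A multiple \<open>s x\<close> of \<open>x\<close> is integral and therefore an element \<open>b\<close> of \<open>B\<close>, by normality. As \<open>x\<close> is algebraic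
  over a field on which \<open>\<Delta>\<close> vanishes, \<open>\<Delta>\<close> kills \<open>x\<close> and \<open>b\<close>.
\<close>

lemma frac_field_A_of_algebraically_closed:
  assumes \<Delta>: "\<Delta> \<subseteq> LND" and char: "CHAR('b::idom) = 0" and normal: "normal_domain (UNIV :: 'b set)"
    and x: "algebraic_over (frac_field (A_of \<Delta>)) (x :: 'b fract)"
  shows "x \<in> frac_field (A_of \<Delta>)"
proof -
  let ?A = "A_of \<Delta>"
  note A = is_subring_A_of[OF \<Delta>]
  obtain p where p: "p \<noteq> 0" "\<And>i. coeff p i \<in> frac_field ?A" "poly p x = 0"
    using x unfolding algebraic_over_def by blast
  have "coeff p i \<in> localization (?A - {0}) ?A" for i
    using p(2)[of i] by (simp add: frac_field_def)
  then obtain d q where d: "d \<in> ?A" "d \<noteq> 0"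
    and q: "\<And>i. coeff q i \<in> ?A" "fract_poly q = smult (to_fract d) p"
    by (rule localization_clear_denominators[OF A A subset_refl]) (assumption | rule that)+
  have q0: "q \<noteq> 0" using q(2) d p(1) by auto
  define s where "s = lead_coeff q"
  have s: "s \<noteq> 0" "s \<in> ?A" using q0 q(1) by (auto simp: s_def)
  define m where "m = smult (inverse (to_fract s)) (fract_poly q)"
  have dm: "degree m = degree q" using s by (simp add: m_def degree_map_poly)
  have "to_fract s * x \<in> range to_fract"
  proof (rule normal_domain_integral[OF normal])
    show "lead_coeff m = 1"
      unfolding dm using s by (simp add: m_def coeff_map_poly s_def[symmetric])
    show "poly m x = 0" by (simp add: m_def q(2) p(3))
    show "to_fract s * coeff m i \<in> range to_fract" for i
      using s by (simp add: m_def coeff_map_poly flip: mult.assoc)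
  qed
  then obtain b where b: "to_fract s * x = to_fract b" by auto
  have "D b = 0" if D: "D \<in> \<Delta>" for D
  proof -
    have "D \<in> LND" using D \<Delta> by blast
    note dD = LND_derivation[OF this]
    note vanish = frac_deriv_vanishes_on_frac_A_of[OF \<Delta> D]
    have "frac_deriv D x = 0"
      by (rule derivation_vanishes_on_algebraic[OF is_ring_hom_id
            derivation_frac_deriv[OF dD, unfolded derivation_iff_along] _ CHAR_fract[OF char]
            subfield_subring[OF is_subfield_frac_field[OF A]] vanish x])
    then have "frac_deriv D (to_fract b) = 0"
      using vanish[OF to_fract_in_frac_field[OF A s(2)]]
      by (simp add: derivation_mult[OF derivation_frac_deriv[OF dD]] flip: b)
    then show ?thesis by (simp add: frac_deriv_to_fract[OF dD])
  qed
  then have "b \<in> ?A" by (simp add: A_of_iff)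
  moreover have "x = to_fract b / to_fract s" using b s by (simp add: field_simps)
  ultimately show ?thesis unfolding frac_field_iff using s by blast
qed

section \<open>The exponential of a derivation\<close>

definition fps_coeffwise :: "('a \<Rightarrow> 'a) \<Rightarrow> 'a fps \<Rightarrow> 'a fps" where
  "fps_coeffwise d F = Abs_fps (\<lambda>n. d (fps_nth F n))"

lemma fps_coeffwise_nth [simp]: "fps_nth (fps_coeffwise d F) n = d (fps_nth F n)"
  by (simp add: fps_coeffwise_def)

text \<open>
  The exponential \<open>exp (T d) x\<close>. The factorial is cast from the naturals because \<open>fact\<close> at type \<open>'a\<close> would
  restrict \<open>'a\<close> to a class of characteristic zero.
\<close>

definition flow :: "('a::field \<Rightarrow> 'a) \<Rightarrow> 'a \<Rightarrow> 'a fps" where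
  "flow d x = Abs_fps (\<lambda>n. (d ^^ n) x / of_nat (fact n))"

lemma flow_nth: "fps_nth (flow d x) n = (d ^^ n) x / of_nat (fact n)"
  by (simp add: flow_def)

lemma flow_nth_0 [simp]: "fps_nth (flow d x) 0 = x"
  by (simp add: flow_nth)

lemma flow_eq_iff: "flow d x = flow d y \<longleftrightarrow> x = y"
  by (metis flow_nth_0)

context
  fixes d :: "'a::field \<Rightarrow> 'a"
  assumes d: "derivation d"
begin

lemma derivation_fps_coeffwise: "derivation (fps_coeffwise d)"
  unfolding derivation_def
  by (auto intro!: fps_ext simp: derivation_add[OF d] derivation_mult[OF d] derivation_sum[OF d]
      fps_mult_nth sum.distrib)

lemma fps_coeffwise_const: "fps_coeffwise d (fps_const a) = fps_const (d a)"
  by (intro fps_ext) (simp add: derivation_0[OF d])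

lemma fps_coeffwise_poly: "fps_coeffwise d (fps_of_poly p) = fps_of_poly (map_poly d p)"
  by (intro fps_ext) (simp add: coeff_map_poly derivation_0[OF d])

lemma derivation_divide_of_nat: "d (x / of_nat k) = d x / of_nat k"
proof (cases "of_nat k = (0::'a)")
  case False
  have dk: "d (of_nat k) = 0"
    by (induction k) (simp_all add: derivation_0[OF d] derivation_1[OF d] derivation_add[OF d])
  have "d x = d (x / of_nat k * of_nat k)" using False by simp
  also have "\<dots> = d (x / of_nat k) * of_nat k"
    unfolding derivation_mult[OF d] dk by simp
  finally show ?thesis using False by simp
qed (simp add: derivation_0[OF d])

lemma flow_const: "d x = 0 \<Longrightarrow> flow d x = fps_const x"
proof (intro fps_ext)
  fix n assume "d x = 0"
  then have "(d ^^ Suc n) x = 0" for n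
    by (induction n) (simp_all add: derivation_0[OF d])
  then show "fps_nth (flow d x) n = fps_nth (fps_const x) n"
    by (cases n) (simp_all add: flow_nth)
qed

context
  assumes char: "CHAR('a) = 0"
begin

lemma of_nat_Suc_nonzero: "of_nat (Suc n) \<noteq> (0 :: 'a)"
  using char by (simp add: of_nat_eq_0_iff_char_dvd del: of_nat_Suc)

lemma fps_deriv_flow: "fps_deriv (flow d x) = fps_coeffwise d (flow d x)"
proof (intro fps_ext)
  fix n
  have "fps_nth (fps_deriv (flow d x)) n = of_nat (Suc n) * ((d ^^ Suc n) x / of_nat (fact (Suc n)))"
    by (simp only: fps_deriv_nth flow_nth Suc_eq_plus1)
  also have "\<dots> = of_nat (Suc n) * ((d ^^ Suc n) x / (of_nat (Suc n) * of_nat (fact n)))"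
    by (simp only: fact_Suc of_nat_mult of_nat_id)
  also have "\<dots> = (d ^^ Suc n) x / of_nat (fact n)"
    by (simp only: times_divide_eq_right mult_divide_mult_cancel_left[OF of_nat_Suc_nonzero])
  finally show "fps_nth (fps_deriv (flow d x)) n = fps_nth (fps_coeffwise d (flow d x)) n"
    by (simp add: flow_nth derivation_divide_of_nat)
qed

text \<open>
  The exponential is the only solution of \<open>dF/dT = d F\<close> with initial value \<open>x\<close>. This replaces the binomial
  computation in the proof that it is multiplicative.
\<close>

lemma flow_unique:
  assumes "fps_deriv F = fps_coeffwise d F" "fps_nth F 0 = x"
  shows "F = flow d x"
proof (intro fps_ext)
  have step: "fps_nth G (Suc n) = d (fps_nth G n) / of_nat (Suc n)"
    if "fps_deriv G = fps_coeffwise d G" for G n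
  proof -
    have "of_nat (Suc n) * fps_nth G (Suc n) = d (fps_nth G n)"
      using arg_cong[OF that, of "\<lambda>F. fps_nth F n"] by simp
    then show ?thesis using of_nat_Suc_nonzero[of n] by (simp add: field_simps del: of_nat_Suc)
  qed
  fix n show "fps_nth F n = fps_nth (flow d x) n"
    by (induction n) (simp_all only: assms(2) flow_nth_0 step[OF assms(1)] step[OF fps_deriv_flow])
qed

lemma is_ring_hom_flow: "is_ring_hom (flow d)"
  unfolding is_ring_hom_def
proof (intro conjI allI)
  show "flow d 1 = 1" using flow_const[of 1] by (simp add: derivation_1[OF d])
  fix x y
  note dc = derivation_fps_coeffwise
  show "flow d (x + y) = flow d x + flow d y"
    by (rule flow_unique[symmetric]) (simp_all add: fps_deriv_flow derivation_add[OF dc])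
  show "flow d (x * y) = flow d x * flow d y"
    by (rule flow_unique[symmetric]) (simp_all add: fps_deriv_flow derivation_mult[OF dc])
qed

lemma flow_eq_0: "flow d x = 0 \<Longrightarrow> x = 0"
  by (metis flow_nth_0 fps_zero_nth)

end

end

lemma fps_of_poly_if_eventually_zero:
  assumes "\<And>n. n \<ge> N \<Longrightarrow> fps_nth F n = 0"
  shows "\<exists>p. F = fps_of_poly p"
proof
  show "F = fps_of_poly (truncate_fps N F)"
    using assms by (intro fps_ext) (auto simp: coeff_truncate_fps)
qed

lemma frac_deriv_iterate:
  assumes D: "derivation D" and s: "D s = 0" "s \<noteq> 0"
  shows "(frac_deriv D ^^ n) (to_fract a / to_fract s) = to_fract ((D ^^ n) a) / to_fract s"
proof (induction n)
  case (Suc n)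
  have "frac_deriv D (to_fract c / to_fract s) * to_fract s = to_fract (D c)" for c
    using frac_deriv_eq[OF D s(2), of "to_fract c / to_fract s" c] s by simp
  then have "frac_deriv D (to_fract c / to_fract s) = to_fract (D c) / to_fract s" for c
    using s(2) by (simp add: field_simps)
  then show ?case by (simp add: Suc)
qed simp

lemma trdeg_eq_1:
  assumes "trdeg_eq A R 1"
  obtains z where "\<And>y. y \<in> frac_field A \<Longrightarrow> algebraic_over (is_subfield hull (frac_field R \<union> {z})) y"
proof -
  obtain X where X: "transcendence_basis (frac_field R) (frac_field A) X" "card X = 1"
    using assms unfolding trdeg_eq_def by blast
  then obtain z where "X = {z}" by (auto simp: card_1_singleton_iff)
  then show thesis using X(1) that unfolding transcendence_basis_def by blast
qed

section \<open>Polynomial rings in one variable between kernels\<close>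

lemma flow_pcompose:
  assumes d: "derivation (d :: 'a::field \<Rightarrow> 'a)" and char: "CHAR('a) = 0"
    and K: "\<And>i. d (coeff p i) = 0" and u: "fps_of_poly u = flow d x"
  shows "flow d (poly p x) = fps_of_poly (pcompose p u)"
  using K
proof (induction p)
  case 0
  then show ?case by (simp add: ring_hom_0[OF is_ring_hom_flow[OF d char]])
next
  case (pCons a p)
  note hom = is_ring_hom_flow[OF d char]
  have "d a = 0" "\<And>i. d (coeff p i) = 0" using pCons.prems[of 0] pCons.prems[of "Suc _"] by auto
  then show ?case
    by (simp add: pcompose_pCons ring_hom_add[OF hom] ring_hom_mult[OF hom] flow_const[OF d] pCons.IH u
        fps_of_poly_add fps_of_poly_mult fps_of_poly_const)
qed

text \<open>
  The image of the localization \<open>P\<close> under \<open>exp (T D\<^sub>0)\<close> consists of polynomials, as the denominators are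
  constants of \<open>D\<^sub>0\<close>. It is a horizontal subring because \<open>x \<mapsto> t' (exp x)\<^sup>D - t\<^sup>D (exp x)'\<close> is a derivation
  along \<open>exp (T D\<^sub>0)\<close> that vanishes on \<open>Frac R\<close> and on \<open>a0\<close>.
\<close>

lemma horizontal_subring_flow:
  fixes A R :: "'b::idom set" and \<Delta> :: "('b \<Rightarrow> 'b) set"
  assumes char: "CHAR('b) = 0" and \<Delta>: "\<Delta> \<subseteq> LND" and K: "frac_field R = K_of \<Delta>"
    and A: "is_subring A" and R: "is_subring R" "R \<subseteq> A" and trdeg: "trdeg_eq A R 1"
    and D0: "D0 \<in> \<Delta>" and a0: "a0 \<in> A" "D0 a0 \<noteq> 0"
  defines "P \<equiv> localization (R - {0}) A" and "d0 \<equiv> frac_deriv D0"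
  obtains t where "horizontal_subring {p. \<exists>x\<in>P. fps_of_poly p = flow d0 x} (frac_deriv ` \<Delta>) t"
    "\<And>x. x \<in> P \<Longrightarrow> \<exists>p. fps_of_poly p = flow d0 x" "fps_of_poly t = flow d0 (to_fract a0)"
proof -
  have dD: "derivation (frac_deriv D)" if "D \<in> \<Delta>" for D
    using that \<Delta> by (auto intro: derivation_frac_deriv LND_derivation)
  have d0: "derivation d0" using dD D0 by (simp add: d0_def)
  have charF: "CHAR('b fract) = 0" by (rule CHAR_fract[OF char])
  note hom = is_ring_hom_flow[OF d0 charF]
  have KD: "x \<in> frac_field R \<longleftrightarrow> (\<forall>D\<in>\<Delta>. frac_deriv D x = 0)" for x
    by (simp add: K K_of_eq[OF \<Delta>])
  have P: "is_subring P" unfolding P_def by (rule subring_localization[OF R A])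
  have RP: "frac_field R \<subseteq> P" unfolding P_def by (rule frac_field_subset_localization[OF R])
  have PA: "P \<subseteq> frac_field A" unfolding P_def by (rule localization_subset_frac_field[OF R])
  have a0P: "to_fract a0 \<in> P" unfolding P_def by (rule to_fract_in_localization[OF R a0(1)])
  have poly: "\<exists>p. fps_of_poly p = flow d0 x" if x: "x \<in> P" for x
  proof -
    obtain a s where as: "s \<in> R" "s \<noteq> 0" "x = to_fract a / to_fract s"
      using x unfolding P_def localization_iff by auto
    have dD0: "derivation D0" "D0 \<in> LND" using D0 \<Delta> by (auto intro: LND_derivation)
    have "frac_deriv D0 (to_fract s) = 0"
      using KD to_fract_in_frac_field[OF R(1) as(1)] D0 by blast
    then have "D0 s = 0" by (simp add: frac_deriv_to_fract[OF dD0(1)])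
    note iter = frac_deriv_iterate[OF dD0(1) this as(2)]
    obtain N where N: "(D0 ^^ N) a = 0" using dD0(2) by (auto simp: LND_def)
    have "(D0 ^^ n) a = 0" if "n \<ge> N" for n
      using that by (induction n rule: dec_induct) (simp_all add: N derivation_0[OF dD0(1)])
    then have "fps_nth (flow d0 x) n = 0" if "n \<ge> N" for n
      using that by (simp add: flow_nth d0_def as(3) iter)
    then show ?thesis using fps_of_poly_if_eventually_zero by metis
  qed
  obtain t where t: "fps_of_poly t = flow d0 (to_fract a0)" using poly[OF a0P] by blast
  have "coeff t 1 = to_fract (D0 a0)"
  proof -
    have "coeff t 1 = fps_nth (flow d0 (to_fract a0)) 1" by (simp flip: t)
    then show ?thesis using D0 \<Delta> by (auto simp: flow_nth d0_def frac_deriv_to_fract LND_derivation)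
  qed
  then have degt: "degree t > 0" using a0(2) by (metis coeff_eq_0 gr0I less_numeral_extra(1) to_fract_eq_0_iff)
  obtain z where z: "\<And>y. y \<in> frac_field A \<Longrightarrow> algebraic_over (is_subfield hull (frac_field R \<union> {z})) y"
    using trdeg_eq_1[OF trdeg] by blast
  have a0_transc: "\<not> algebraic_over (frac_field R) (to_fract a0)"
  proof
    assume "algebraic_over (frac_field R) (to_fract a0)"
    then have "d0 (to_fract a0) = 0"
      by (rule derivation_vanishes_on_algebraic[OF is_ring_hom_id d0[unfolded derivation_iff_along] _ charF
            subfield_subring[OF is_subfield_frac_field[OF R(1)]], rotated 2])
        (use KD D0 in \<open>auto simp: d0_def\<close>)
    then show False using a0(2) D0 \<Delta> by (auto simp: d0_def frac_deriv_to_fract LND_derivation)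
  qed
  show thesis
  proof (rule that[OF _ poly t])
    show "horizontal_subring {p. \<exists>x\<in>P. fps_of_poly p = flow d0 x} (frac_deriv ` \<Delta>) t"
    proof
      show "CHAR('b fract) = 0" by (fact charF)
      show "derivation D" if "D \<in> frac_deriv ` \<Delta>" for D using that dD by auto
      show "[:a:] \<in> {p. \<exists>x\<in>P. fps_of_poly p = flow d0 x}"
        if "\<And>D. D \<in> frac_deriv ` \<Delta> \<Longrightarrow> D a = 0" for a
      proof -
        have "a \<in> P" using KD RP that by auto
        moreover have "d0 a = 0" using that D0 by (simp add: d0_def)
        ultimately show ?thesis
          using flow_const[OF d0, of a] by (intro CollectI bexI[of _ a]) (simp_all add: fps_of_poly_const)
      qed
      show "f - g \<in> {p. \<exists>x\<in>P. fps_of_poly p = flow d0 x}"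
        if "f \<in> {p. \<exists>x\<in>P. fps_of_poly p = flow d0 x}" "g \<in> {p. \<exists>x\<in>P. fps_of_poly p = flow d0 x}" for f g
        using that subring_diff[OF P] by (auto simp: fps_of_poly_diff simp flip: ring_hom_diff[OF hom])
      show "f * g \<in> {p. \<exists>x\<in>P. fps_of_poly p = flow d0 x}"
        if "f \<in> {p. \<exists>x\<in>P. fps_of_poly p = flow d0 x}" "g \<in> {p. \<exists>x\<in>P. fps_of_poly p = flow d0 x}" for f g
        using that subring_mult[OF P] by (auto simp: fps_of_poly_mult simp flip: ring_hom_mult[OF hom])
      show "t \<in> {p. \<exists>x\<in>P. fps_of_poly p = flow d0 x}" using t a0P by auto
      show "degree t > 0" by (fact degt)
    next
      fix d f assume "d \<in> frac_deriv ` \<Delta>" and f: "f \<in> {p. \<exists>x\<in>P. fps_of_poly p = flow d0 x}"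
      then obtain D where D: "D \<in> \<Delta>" "d = frac_deriv D" by auto
      have d: "derivation d" using dD D by simp
      define \<delta> where "\<delta> x = fps_of_poly (pderiv t) * fps_coeffwise d (flow d0 x)
        - fps_of_poly (map_poly d t) * fps_deriv (flow d0 x)" for x
      have along: "derivation_along (flow d0) \<delta>"
        unfolding derivation_along_def \<delta>_def ring_hom_add[OF hom] ring_hom_mult[OF hom]
          derivation_add[OF derivation_fps_coeffwise[OF d]] derivation_mult[OF derivation_fps_coeffwise[OF d]]
        by (auto simp: algebra_simps)
      have zero: "\<delta> y = 0" if "y \<in> frac_field A" for y
      proof (rule derivation_vanishes_in_trdeg_1[OF hom along _ charF is_subfield_frac_field[OF R(1)] _
            _ a0_transc _ z that])
        show "x = 0" if "flow d0 x = 0" for x using flow_eq_0[OF d0 charF that] .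
        show "\<delta> a = 0" if "a \<in> frac_field R" for a
        proof -
          have "d0 a = 0" "d a = 0" using that KD D0 D by (auto simp: d0_def)
          then show ?thesis by (simp add: \<delta>_def flow_const[OF d0] fps_coeffwise_const[OF d])
        qed
        show "to_fract a0 \<in> frac_field A" using a0P PA by blast
        show "\<delta> (to_fract a0) = 0"
          by (simp add: \<delta>_def fps_coeffwise_poly[OF d] fps_of_poly_pderiv flip: t)
      qed
      obtain x where x: "x \<in> P" "fps_of_poly f = flow d0 x" using f by auto
      have "\<delta> x = 0" using zero x(1) PA by blast
      then have "fps_of_poly (pderiv t * map_poly d f) = fps_of_poly (map_poly d t * pderiv f)"
        by (simp add: \<delta>_def fps_coeffwise_poly[OF d] fps_of_poly_pderiv fps_of_poly_mult flip: x(2))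
      then show "pderiv t * map_poly d f = map_poly d t * pderiv f"
        by (simp only: fps_of_poly_eq_iff)
    qed
  qed
qed

text \<open>
  Descent gives \<open>x \<in> Frac A\<close> with \<open>P \<subseteq> K[x]\<close>. An element of \<open>A\<close> outside \<open>R\<close> is a nonconstant polynomial in
  \<open>x\<close> over \<open>K\<close>, and this is an integral equation for \<open>x\<close> over \<open>P\<close>; hence \<open>x \<in> P\<close>.
\<close>

theorem A1_star_if_frac_in_K_sets:
  fixes A R :: "'b::idom set"
  assumes char: "CHAR('b) = 0" and normal: "normal_domain (UNIV :: 'b set)"
    and A_in: "A \<in> A_sets" and R_in: "R \<in> A_sets" and RA: "R \<subset> A" and trdeg: "trdeg_eq A R 1"
    and K_in: "frac_field R \<in> K_sets"
  shows "R \<in> A1_star A"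
proof -
  obtain \<Delta> where \<Delta>: "\<Delta> \<subseteq> LND" "frac_field R = K_of \<Delta>" using K_in by (auto simp: K_sets_def)
  obtain \<Gamma> where \<Gamma>: "\<Gamma> \<subseteq> LND" "A = A_of \<Gamma>" using A_in by (auto simp: A_sets_def)
  obtain \<Gamma>' where \<Gamma>': "\<Gamma>' \<subseteq> LND" "R = A_of \<Gamma>'" using R_in by (auto simp: A_sets_def)
  have A: "is_subring A" and R: "is_subring R" using is_subring_A_of \<Gamma> \<Gamma>' by auto
  have charF: "CHAR('b fract) = 0" by (rule CHAR_fract[OF char])
  have dD: "derivation D" "derivation (frac_deriv D)" if "D \<in> \<Delta>" for D
    using that \<Delta>(1) by (auto intro: derivation_frac_deriv LND_derivation)
  have KD: "x \<in> frac_field R \<longleftrightarrow> (\<forall>D\<in>\<Delta>. frac_deriv D x = 0)" for x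
    by (simp add: \<Delta>(2) K_of_eq[OF \<Delta>(1)])
  obtain a where a: "a \<in> A" "a \<notin> R" using RA by blast
  then have "to_fract a \<notin> frac_field R" using A_of_frac[OF \<Gamma>'(1)] \<Gamma>'(2) by blast
  then obtain D0 where D0: "D0 \<in> \<Delta>" "D0 a \<noteq> 0"
    using KD by (auto simp: frac_deriv_to_fract dD)
  define d0 where "d0 = frac_deriv D0"
  define P where "P = localization (R - {0}) A"
  have d0: "derivation d0" using dD D0 by (simp add: d0_def)
  note hom = is_ring_hom_flow[OF d0 charF]
  note RA' = psubset_imp_subset[OF RA]
  have P: "is_subring P" unfolding P_def by (rule subring_localization[OF R RA' A])
  have RP: "frac_field R \<subseteq> P" unfolding P_def by (rule frac_field_subset_localization[OF R RA'])
  have PA: "P \<subseteq> frac_field A" unfolding P_def by (rule localization_subset_frac_field[OF R RA'])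
  have aP: "to_fract a \<in> P" unfolding P_def by (rule to_fract_in_localization[OF R RA' a(1)])
  obtain t where hs: "horizontal_subring {p. \<exists>x\<in>P. fps_of_poly p = flow d0 x} (frac_deriv ` \<Delta>) t"
    and polyP: "\<And>x. x \<in> P \<Longrightarrow> \<exists>p. fps_of_poly p = flow d0 x"
    and t: "fps_of_poly t = flow d0 (to_fract a)"
    by (rule horizontal_subring_flow[OF char \<Delta> A R RA' trdeg D0(1) a(1) D0(2)])
      (unfold P_def d0_def, blast)
  obtain u b where u: "degree u > 0" and b: "\<exists>x\<in>P. fps_of_poly b = flow d0 x" "b \<noteq> 0"
    "\<exists>x\<in>P. fps_of_poly (b * u) = flow d0 x"
    and gen: "\<And>f. \<exists>x\<in>P. fps_of_poly f = flow d0 x \<Longrightarrow>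
      \<exists>\<psi>. (\<forall>i. \<forall>D\<in>frac_deriv ` \<Delta>. D (coeff \<psi> i) = 0) \<and> f = pcompose \<psi> u"
    by (rule horizontal_subring.descent[OF hs]) blast
  obtain b0 where b0: "b0 \<in> P" "fps_of_poly b = flow d0 b0" using b by blast
  obtain c0 where c0: "c0 \<in> P" "fps_of_poly (b * u) = flow d0 c0" using b by blast
  have "b0 \<noteq> 0"
  proof
    assume "b0 = 0"
    then have "fps_of_poly b = fps_of_poly 0" using b0(2) by (simp add: ring_hom_0[OF hom])
    then show False using b(2) by (simp only: fps_of_poly_eq_iff)
  qed
  define x where "x = c0 / b0"
  have "flow d0 b0 * flow d0 x = flow d0 c0"
    using \<open>b0 \<noteq> 0\<close> by (simp add: x_def flip: ring_hom_mult[OF hom])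
  also have "\<dots> = flow d0 b0 * fps_of_poly u"
    by (simp add: fps_of_poly_mult flip: b0(2) c0(2))
  finally have "flow d0 b0 * flow d0 x = flow d0 b0 * fps_of_poly u" .
  then have ux: "fps_of_poly u = flow d0 x"
    using \<open>b0 \<noteq> 0\<close> flow_eq_0[OF d0 charF, of b0] by auto
  have xA: "x \<in> frac_field A"
    unfolding x_def using b0 c0 PA by (intro subfield_divide is_subfield_frac_field A) auto
  have gen_x: "\<exists>\<psi>. (\<forall>i. coeff \<psi> i \<in> frac_field R) \<and> y = poly \<psi> x \<and> flow d0 y = fps_of_poly (pcompose \<psi> u)"
    if y: "y \<in> P" for y
  proof -
    obtain f where f: "fps_of_poly f = flow d0 y" using polyP[OF y] by blast
    then obtain \<psi> where \<psi>: "\<forall>i. \<forall>D\<in>frac_deriv ` \<Delta>. D (coeff \<psi> i) = 0" "f = pcompose \<psi> u"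
      using gen[of f] y by blast
    have "flow d0 (poly \<psi> x) = fps_of_poly (pcompose \<psi> u)"
      using \<psi>(1) D0(1) by (intro flow_pcompose[OF d0 charF _ ux]) (auto simp: d0_def)
    then have "y = poly \<psi> x" using f \<psi>(2) flow_eq_iff by metis
    then show ?thesis using \<psi> f KD by (intro exI[of _ \<psi>]) auto
  qed
  have xP: "x \<in> P"
  proof -
    obtain \<psi> where \<psi>: "\<forall>i. coeff \<psi> i \<in> frac_field R" "to_fract a = poly \<psi> x"
      "flow d0 (to_fract a) = fps_of_poly (pcompose \<psi> u)" using gen_x[OF aP] by blast
    have deg: "degree \<psi> > 0"
    proof (rule ccontr)
      assume "\<not> degree \<psi> > 0"
      then obtain k where "\<psi> = [:k:]" using degree_eq_zeroE by auto
      then have "to_fract a \<in> frac_field R" using \<psi>(1)[rule_format, of 0] \<psi>(2) by simp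
      then show False using \<open>to_fract a \<notin> frac_field R\<close> by blast
    qed
    define l where "l = lead_coeff \<psi>"
    have l: "l \<noteq> 0" "l \<in> frac_field R" using deg \<psi>(1) by (auto simp: l_def)
    define p where "p = smult (inverse l) (\<psi> - [:to_fract a:])"
    have dp: "degree (\<psi> - [:to_fract a:]) = degree \<psi>"
      using deg by (metis add_uminus_conv_diff degree_add_eq_left degree_minus degree_pCons_0)
    have lead: "lead_coeff p = 1"
    proof -
      have "coeff (\<psi> - [:to_fract a:]) (degree \<psi>) = l"
        using deg by (simp add: l_def coeff_eq_0)
      then show ?thesis using l(1) by (simp add: p_def dp)
    qed
    have root: "poly p x = 0" using \<psi>(2) by (simp add: p_def)
    have coeffs: "coeff p i \<in> P" for i
    proof -
      have "coeff (\<psi> - [:to_fract a:]) i \<in> P"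
        using \<psi>(1) RP aP subring_0[OF P]
        by (auto simp: coeff_pCons intro!: subring_diff[OF P] split: nat.splits)
      moreover have "inverse l \<in> P"
        using l RP is_subfield_frac_field[OF R] by (auto simp: is_subfield_def)
      ultimately show ?thesis by (simp add: p_def subring_mult[OF P])
    qed
    obtain s q where s: "s \<in> R" "s \<noteq> 0"
      and q: "\<And>i. coeff q i \<in> A" "fract_poly q = smult (to_fract s) p"
      by (rule localization_clear_denominators[OF A R RA' coeffs[unfolded P_def]]) (assumption | rule that)+
    have "to_fract s * coeff p i = to_fract (coeff q i)" for i
      using arg_cong[OF q(2), of "\<lambda>p. coeff p i"] by (simp add: coeff_map_poly)
    then obtain y where y: "to_fract s * x = to_fract y"
      using normal_domain_integral[OF normal lead root, of s] by auto
    have "to_fract s \<in> frac_field A" using s RA A by (intro to_fract_in_frac_field) auto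
    then have "to_fract y \<in> frac_field A"
      unfolding y[symmetric] using xA is_subfield_frac_field[OF A] by (auto simp: is_subfield_def subring_mult)
    then have "y \<in> A" using A_of_frac \<Gamma> by blast
    moreover have "x = to_fract y / to_fract s" using s y by (simp add: field_simps)
    ultimately show ?thesis unfolding P_def localization_iff using s by blast
  qed
  have transc: "\<not> algebraic_over (frac_field R) x"
  proof
    assume "algebraic_over (frac_field R) x"
    then have "d0 x = 0"
      by (rule derivation_vanishes_on_algebraic[OF is_ring_hom_id d0[unfolded derivation_iff_along] _ charF
            subfield_subring[OF is_subfield_frac_field[OF R]], rotated 2])
        (use KD D0 in \<open>auto simp: d0_def\<close>)
    then have "fps_of_poly u = fps_of_poly [:x:]" using ux flow_const[OF d0] by (simp add: fps_of_poly_const)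
    then show False using u by (simp add: fps_of_poly_eq_iff)
  qed
  have "bij_betw (\<lambda>p. poly p x) {p. \<forall>i. coeff p i \<in> frac_field R} P"
    unfolding bij_betw_def
  proof
    show "inj_on (\<lambda>p. poly p x) {p. \<forall>i. coeff p i \<in> frac_field R}"
    proof (rule inj_onI)
      fix p q assume pq: "p \<in> {p. \<forall>i. coeff p i \<in> frac_field R}" "q \<in> {p. \<forall>i. coeff p i \<in> frac_field R}"
        and eq: "poly p x = poly q x"
      have "\<forall>i. coeff (p - q) i \<in> frac_field R"
        using pq subring_diff[OF subfield_subring[OF is_subfield_frac_field[OF R]]] by auto
      moreover have "poly (p - q) x = 0" using eq by simp
      ultimately have "p - q = 0" using transc unfolding algebraic_over_def by blast
      then show "p = q" by simp
    qed
    show "(\<lambda>p. poly p x) ` {p. \<forall>i. coeff p i \<in> frac_field R} = P"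
    proof (intro equalityI subsetI)
      fix y assume "y \<in> (\<lambda>p. poly p x) ` {p. \<forall>i. coeff p i \<in> frac_field R}"
      then show "y \<in> P" using RP xP by (auto intro!: subring_poly[OF P])
    qed (use gen_x in blast)
  qed
  then have "polynomial_ring_one_var (frac_field R) P" unfolding polynomial_ring_one_var_def by blast
  moreover have "algebraically_closed_in R A"
    unfolding algebraically_closed_in_def using A_of_algebraically_closed[OF \<Gamma>'(1) char] \<Gamma>'(2) by blast
  ultimately show ?thesis using R RA by (auto simp: A1_star_def P_def)
qed

section \<open>Descending the chain\<close>

lemma affine_domain_char_0:
  assumes "affine_domain (\<phi> :: 'k::field_char_0 \<Rightarrow> 'b::idom)"
  shows "CHAR('b) = 0"
proof -
  have hom: "is_ring_hom \<phi>" using assms by (simp add: affine_domain_def)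
  have "of_nat n \<noteq> (0 :: 'b)" if "n > 0" for n
  proof
    assume "of_nat n = (0 :: 'b)"
    then have "\<phi> (of_nat n * inverse (of_nat n)) = 0"
      by (simp add: ring_hom_mult[OF hom] ring_hom_of_nat[OF hom])
    then show False using that by (simp add: ring_hom_1[OF hom])
  qed
  then show ?thesis by (simp add: CHAR_eq0_iff)
qed

text \<open>
  The fraction field of \<open>R\<close> is the field of constants of \<open>\<Delta> \<union> \<Gamma>\<close>, where \<open>Frac A = K_of \<Delta>\<close> and \<open>R = A_of \<Gamma>\<close>:
  a further constant would be a transcendental element of \<open>Frac A\<close> killed by \<open>\<Gamma>\<close>, so that \<open>\<Gamma>\<close> would kill
  all of \<open>A\<close>.
\<close>

theorem frac_in_K_sets_descends:
  fixes A R :: "'b::idom set"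
  assumes char: "CHAR('b) = 0" and normal: "normal_domain (UNIV :: 'b set)"
    and A_in: "A \<in> A_sets" and R_in: "R \<in> A_sets" and RA: "R \<subset> A" and trdeg: "trdeg_eq A R 1"
    and K_in: "frac_field A \<in> K_sets"
  shows "frac_field R \<in> K_sets"
proof -
  obtain \<Delta> where \<Delta>: "\<Delta> \<subseteq> LND" "frac_field A = K_of \<Delta>" using K_in by (auto simp: K_sets_def)
  obtain \<Gamma> where \<Gamma>: "\<Gamma> \<subseteq> LND" "R = A_of \<Gamma>" using R_in by (auto simp: A_sets_def)
  obtain \<Gamma>' where \<Gamma>': "\<Gamma>' \<subseteq> LND" "A = A_of \<Gamma>'" using A_in by (auto simp: A_sets_def)
  have R: "is_subring R" and A: "is_subring A" using is_subring_A_of \<Gamma> \<Gamma>' by auto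
  obtain z where z: "\<And>y. y \<in> frac_field A \<Longrightarrow> algebraic_over (is_subfield hull (frac_field R \<union> {z})) y"
    using trdeg_eq_1[OF trdeg] by blast
  have R_const: "frac_deriv D x = 0" if "x \<in> frac_field R" "D \<in> \<Gamma>" for x D
    using frac_deriv_vanishes_on_frac_A_of[OF \<Gamma>(1) that(2)] that(1) \<Gamma>(2) by blast
  have "frac_field R = K_of (\<Delta> \<union> \<Gamma>)"
  proof (intro equalityI subsetI)
    fix x assume x: "x \<in> frac_field R"
    then have "x \<in> K_of \<Delta>" using frac_field_mono[of R A] RA \<Delta>(2) by blast
    then show "x \<in> K_of (\<Delta> \<union> \<Gamma>)"
      using R_const[OF x] \<Delta>(1) \<Gamma>(1) by (simp add: K_of_eq ball_Un)
  next
    fix x assume x: "x \<in> K_of (\<Delta> \<union> \<Gamma>)"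
    then have const: "frac_deriv D x = 0" if "D \<in> \<Delta> \<union> \<Gamma>" for D
      using \<Delta>(1) \<Gamma>(1) that by (simp add: K_of_eq)
    then have xA: "x \<in> frac_field A" using \<Delta> by (simp add: K_of_eq)
    show "x \<in> frac_field R"
    proof (rule ccontr)
      assume "x \<notin> frac_field R"
      then have transc: "\<not> algebraic_over (frac_field R) x"
        using frac_field_A_of_algebraically_closed[OF \<Gamma>(1) char normal] \<Gamma>(2) by blast
      have "D a = 0" if D: "D \<in> \<Gamma>" and a: "a \<in> A" for D a
      proof -
        have dD: "derivation D" using D \<Gamma>(1) by (auto intro: LND_derivation)
        have along: "derivation_along (\<lambda>x. x) (frac_deriv D)"
          using derivation_frac_deriv[OF dD] by (simp add: derivation_iff_along)
        have "frac_deriv D (to_fract a) = 0"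
          by (rule derivation_vanishes_in_trdeg_1[OF is_ring_hom_id along _ CHAR_fract[OF char]
                is_subfield_frac_field[OF R] R_const[OF _ D] xA transc const[OF UnI2[OF D]] z
                to_fract_in_frac_field[OF A a]])
        then show ?thesis by (simp add: frac_deriv_to_fract[OF dD])
      qed
      then have "A \<subseteq> R" unfolding \<Gamma>(2) by (auto simp: A_of_iff)
      then show False using RA by blast
    qed
  qed
  then show ?thesis using \<Delta>(1) \<Gamma>(1) unfolding K_sets_def by blast
qed

section \<open>Towers of simple transcendental extensions\<close>

lemma eval_at_self_superset:
  assumes "finite M" "Poly_Mapping.keys p \<subseteq> M"
  shows "eval_at_self p = (\<Sum>m\<in>M. Poly_Mapping.lookup p m * (\<Prod>x\<in>Poly_Mapping.keys m. x ^ Poly_Mapping.lookup m x))"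
  unfolding eval_at_self_def using assms
  by (intro sum.mono_neutral_left) (auto simp: in_keys_iff)

lemma algebraically_independent_empty: "algebraically_independent K {}"
  unfolding algebraically_independent_def
proof (intro allI impI)
  fix p :: "('a \<Rightarrow>\<^sub>0 nat) \<Rightarrow>\<^sub>0 'a"
  assume p: "(\<forall>m. Poly_Mapping.lookup p m \<in> K) \<and> (\<forall>m\<in>Poly_Mapping.keys p. Poly_Mapping.keys m \<subseteq> {}) \<and>
    eval_at_self p = 0"
  then have sub: "Poly_Mapping.keys p \<subseteq> {0}" by auto
  then have "Poly_Mapping.lookup p 0 = 0" using p eval_at_self_superset[of "{0}" p] by simp
  then show "p = 0" using sub by (intro poly_mapping_eqI) (metis in_keys_iff lookup_zero singletonD subsetD)
qed

definition monomial_value :: "('a::comm_ring_1 \<Rightarrow>\<^sub>0 nat) \<Rightarrow> 'a" where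
  "monomial_value m = (\<Prod>x\<in>Poly_Mapping.keys m. x ^ Poly_Mapping.lookup m x)"

lemma keys_single_plus:
  assumes "t \<notin> Poly_Mapping.keys m"
  shows "Poly_Mapping.keys (m + Poly_Mapping.single t k) \<subseteq> insert t (Poly_Mapping.keys m)"
    and "Poly_Mapping.lookup (m + Poly_Mapping.single t k) t = k"
  using assms by (auto simp: in_keys_iff lookup_add lookup_single when_def split: if_splits)

lemma monomial_value_single_plus:
  assumes "t \<notin> Poly_Mapping.keys m"
  shows "monomial_value (m + Poly_Mapping.single t k) = monomial_value m * t ^ k"
proof -
  have "monomial_value (m + Poly_Mapping.single t k)
      = (\<Prod>x\<in>insert t (Poly_Mapping.keys m). x ^ Poly_Mapping.lookup (m + Poly_Mapping.single t k) x)"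
    unfolding monomial_value_def using keys_single_plus(1)[OF assms, of k]
    by (intro prod.mono_neutral_left) (auto simp: in_keys_iff)
  also have "\<dots> = t ^ k * (\<Prod>x\<in>Poly_Mapping.keys m. x ^ Poly_Mapping.lookup (m + Poly_Mapping.single t k) x)"
    using assms keys_single_plus(2)[OF assms, of k] by simp
  also have "(\<Prod>x\<in>Poly_Mapping.keys m. x ^ Poly_Mapping.lookup (m + Poly_Mapping.single t k) x) = monomial_value m"
    unfolding monomial_value_def using assms
    by (intro prod.cong refl) (auto simp: lookup_add lookup_single when_def)
  finally show ?thesis by (simp add: mult.commute)
qed

lemma subring_prod_power:
  assumes "is_subring A" "\<And>x. x \<in> I \<Longrightarrow> x \<in> A"
  shows "(\<Prod>x\<in>I. x ^ f x) \<in> A"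
  using assms(2) by (induction I rule: infinite_finite_induct)
    (auto simp: subring_1[OF assms(1)] intro!: subring_mult[OF assms(1)] subring_power[OF assms(1)])

lemma subring_sum:
  assumes "is_subring A" "\<And>x. x \<in> I \<Longrightarrow> f x \<in> A"
  shows "sum f I \<in> A"
  using assms(2) by (induction I rule: infinite_finite_induct)
    (auto simp: subring_0[OF assms(1)] intro!: subring_add[OF assms(1)])

text \<open>
  Collecting the monomials of \<open>p\<close> by their exponent of \<open>t\<close> turns a relation into an equation for \<open>t\<close> over
  \<open>K(X)\<close>. Its coefficients vanish as \<open>t\<close> is transcendental, and each of them is a relation between the elements
  of \<open>X\<close>.
\<close>

lemma algebraically_independent_insert:
  assumes K: "is_subfield K" and X: "algebraically_independent K X"
    and t: "\<not> algebraic_over (is_subfield hull (K \<union> X)) t"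
  shows "algebraically_independent K (insert t X)"
  unfolding algebraically_independent_def
proof (intro allI impI)
  fix p :: "('a \<Rightarrow>\<^sub>0 nat) \<Rightarrow>\<^sub>0 'a"
  assume p: "(\<forall>m. Poly_Mapping.lookup p m \<in> K) \<and>
    (\<forall>m\<in>Poly_Mapping.keys p. Poly_Mapping.keys m \<subseteq> insert t X) \<and> eval_at_self p = 0"
  let ?H = "is_subfield hull (K \<union> X)"
  have H: "is_subring ?H" by (rule subfield_subring[OF is_subfield_hull])
  have tX: "t \<notin> X"
  proof
    assume "t \<in> X"
    then have "t \<in> ?H" by (simp add: hull_inc)
    then have "\<forall>i. coeff [:- t, 1:] i \<in> ?H"
      using subring_0[OF H] subring_1[OF H] subring_uminus[OF H] by (auto simp: coeff_pCons split: nat.splits)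
    moreover have "poly [:- t, 1:] t = 0" "[:- t, 1:] \<noteq> 0" by auto
    ultimately show False using t unfolding algebraic_over_def by blast
  qed
  \<comment> \<open>A monomial is split as a monomial \<open>drop_t m\<close> without \<open>t\<close> times the power \<open>st k\<close> of \<open>t\<close>.\<close>
  define st where "st k = Poly_Mapping.single t (k::nat)" for k
  define drop_t where "drop_t m = m - st (Poly_Mapping.lookup m t)" for m
  have drop_t: "t \<notin> Poly_Mapping.keys (drop_t m)" "drop_t m + st (Poly_Mapping.lookup m t) = m" for m
    by (auto intro!: poly_mapping_eqI simp: drop_t_def st_def in_keys_iff lookup_minus lookup_add lookup_single when_def)
  define M where "M = drop_t ` Poly_Mapping.keys p"
  define N where "N = (\<lambda>m. Poly_Mapping.lookup m t) ` Poly_Mapping.keys p"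
  have fin: "finite M" "finite N" by (simp_all add: M_def N_def)
  have tM: "t \<notin> Poly_Mapping.keys m" if "m \<in> M" for m using that drop_t by (auto simp: M_def)
  have XM: "Poly_Mapping.keys m \<subseteq> X" if "m \<in> M" for m
  proof -
    obtain m' where m': "m' \<in> Poly_Mapping.keys p" "m = drop_t m'" using \<open>m \<in> M\<close> by (auto simp: M_def)
    have "Poly_Mapping.keys m \<subseteq> Poly_Mapping.keys m'"
      unfolding m'(2) drop_t_def by (auto simp: in_keys_iff lookup_minus)
    then show ?thesis using p m'(1) tM[OF that] by blast
  qed
  have inj: "inj_on (\<lambda>(m, k). m + st k) (M \<times> N)"
  proof (rule inj_onI, clarify)
    fix m k m' k' assume a: "m \<in> M" "m' \<in> M" "m + st k = m' + st k'"
    have "k = k'" using keys_single_plus(2)[OF tM] a unfolding st_def by metis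
    then show "m = m' \<and> k = k'" using a(3) by simp
  qed
  have sub: "Poly_Mapping.keys p \<subseteq> (\<lambda>(m, k). m + st k) ` (M \<times> N)"
  proof
    fix m assume "m \<in> Poly_Mapping.keys p"
    then show "m \<in> (\<lambda>(m, k). m + st k) ` (M \<times> N)"
      using drop_t(2)[of m] by (intro image_eqI[of _ _ "(drop_t m, Poly_Mapping.lookup m t)"]) (auto simp: M_def N_def)
  qed
  have val: "monomial_value (m + st k) = monomial_value m * t ^ k" if "m \<in> M" for m k
    unfolding st_def by (rule monomial_value_single_plus[OF tM[OF that]])
  define c where "c k = (\<Sum>m\<in>M. Poly_Mapping.lookup p (m + st k) * monomial_value m)" for k
  have "eval_at_self p = (\<Sum>m\<in>(\<lambda>(m, k). m + st k) ` (M \<times> N). Poly_Mapping.lookup p m * monomial_value m)"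
    unfolding monomial_value_def using fin sub by (intro eval_at_self_superset) auto
  also have "\<dots> = (\<Sum>(m, k)\<in>M \<times> N. Poly_Mapping.lookup p (m + st k) * monomial_value (m + st k))"
    by (subst sum.reindex[OF inj]) (simp add: case_prod_beta)
  also have "\<dots> = (\<Sum>m\<in>M. \<Sum>k\<in>N. Poly_Mapping.lookup p (m + st k) * monomial_value (m + st k))"
    by (rule sum.cartesian_product[symmetric])
  also have "\<dots> = (\<Sum>k\<in>N. \<Sum>m\<in>M. Poly_Mapping.lookup p (m + st k) * monomial_value (m + st k))"
    by (rule sum.swap)
  also have "\<dots> = (\<Sum>k\<in>N. c k * t ^ k)"
    unfolding c_def sum_distrib_right by (intro sum.cong refl) (simp add: val mult.assoc)
  finally have zero: "(\<Sum>k\<in>N. c k * t ^ k) = 0" using p by simp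
  have c_in: "c k \<in> ?H" for k
    unfolding c_def
  proof (intro subring_sum[OF H] subring_mult[OF H])
    show "Poly_Mapping.lookup p (m + st k) \<in> ?H" for m using p by (intro hull_inc) blast
    show "monomial_value m \<in> ?H" if "m \<in> M" for m
      unfolding monomial_value_def using XM[OF that] by (intro subring_prod_power[OF H] hull_inc) auto
  qed
  define q where "q = (\<Sum>k\<in>N. monom (c k) k)"
  have coeff_q: "coeff q k = (if k \<in> N then c k else 0)" for k
    using fin by (simp add: q_def coeff_sum)
  have "poly q t = 0" using zero by (simp add: q_def poly_sum poly_monom)
  moreover have "\<forall>k. coeff q k \<in> ?H" using c_in subring_0[OF H] by (simp add: coeff_q)
  ultimately have "q = 0" using t unfolding algebraic_over_def by blast
  then have c0: "c k = 0" if "k \<in> N" for k using coeff_q[of k] that by simp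
  have all0: "Poly_Mapping.lookup p (m + st k) = 0" if m: "m \<in> M" and k: "k \<in> N" for m k
  proof -
    define P where "P = (\<Sum>m\<in>M. Poly_Mapping.single m (Poly_Mapping.lookup p (m + st k)))"
    have lookup_P: "Poly_Mapping.lookup P m = (if m \<in> M then Poly_Mapping.lookup p (m + st k) else 0)" for m
      using fin by (simp add: P_def lookup_sum lookup_single when_def)
    have keys_P: "Poly_Mapping.keys P \<subseteq> M" by (auto simp: in_keys_iff lookup_P split: if_splits)
    have "eval_at_self P = c k"
      using eval_at_self_superset[OF fin(1) keys_P] by (simp add: lookup_P c_def monomial_value_def)
    moreover have "Poly_Mapping.lookup P m \<in> K" for m
      using p subring_0[OF subfield_subring[OF K]] by (auto simp: lookup_P)
    moreover have "Poly_Mapping.keys m \<subseteq> X" if "m \<in> Poly_Mapping.keys P" for m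
      using keys_P XM that by (meson subsetD)
    ultimately have "P = 0"
      using c0[OF k] by (intro X[unfolded algebraically_independent_def, rule_format]) simp
    then show ?thesis using lookup_P[of m] m by simp
  qed
  have "Poly_Mapping.keys p = {}"
  proof (rule equals0I)
    fix m assume m: "m \<in> Poly_Mapping.keys p"
    then obtain m' k where "m' \<in> M" "k \<in> N" "m = m' + st k" using sub by auto
    then show False using all0 m by (simp add: in_keys_iff)
  qed
  then show "p = 0" by simp
qed

lemma A1_star_simple_transcendental:
  fixes A R :: "'b::idom set"
  assumes A: "is_subring A" and RA: "R \<in> A1_star A"
  obtains x where "frac_field A = is_subfield hull (frac_field R \<union> {x})" "\<not> algebraic_over (frac_field R) x"
proof -
  let ?K = "frac_field R" and ?P = "localization (R - {0}) A"
  have R: "is_subring R" "R \<subseteq> A" using RA by (auto simp: A1_star_def)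
  have K: "is_subring ?K" by (rule subfield_subring[OF is_subfield_frac_field[OF R(1)]])
  obtain x where x: "bij_betw (\<lambda>p. poly p x) {p. \<forall>i. coeff p i \<in> ?K} ?P"
    using RA by (auto simp: A1_star_def polynomial_ring_one_var_def)
  note inA = to_fract_in_localization[OF R] and PA = localization_subset_frac_field[OF R]
  have "[:0, 1:] \<in> {p. \<forall>i. coeff p i \<in> ?K}"
    using subring_0[OF K] subring_1[OF K] by (auto simp: coeff_pCons split: nat.splits)
  then have "x \<in> ?P" using bij_betwE[OF x] by fastforce
  let ?H = "is_subfield hull (?K \<union> {x})"
  have H: "is_subfield ?H" by (rule is_subfield_hull)
  have PH: "?P \<subseteq> ?H"
  proof
    fix y assume "y \<in> ?P"
    then obtain p where "\<forall>i. coeff p i \<in> ?K" "y = poly p x" using x by (auto simp: bij_betw_def)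
    moreover have "poly p x \<in> ?H"
      by (rule subring_poly[OF subfield_subring[OF H]]; rule hull_inc) (use calculation in auto)
    ultimately show "y \<in> ?H" by simp
  qed
  have "frac_field A = ?H"
  proof
    show "frac_field A \<subseteq> ?H"
    proof
      fix y assume "y \<in> frac_field A"
      then obtain a b where "a \<in> A" "b \<in> A" "y = to_fract a / to_fract b" unfolding frac_field_iff by blast
      then have "to_fract a \<in> ?H" "to_fract b \<in> ?H" using inA PH by blast+
      then show "y \<in> ?H" unfolding \<open>y = to_fract a / to_fract b\<close> by (rule subfield_divide[OF H])
    qed
    show "?H \<subseteq> frac_field A"
      using frac_field_mono[OF R(2)] \<open>x \<in> ?P\<close> PA by (intro hull_minimal is_subfield_frac_field A) auto
  qed
  moreover have "\<not> algebraic_over ?K x"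
  proof
    assume "algebraic_over ?K x"
    then obtain p where p: "p \<noteq> 0" "\<forall>i. coeff p i \<in> ?K" "poly p x = 0" unfolding algebraic_over_def by blast
    have "p = 0"
      by (rule inj_onD[OF bij_betw_imp_inj_on[OF x]]) (use p subring_0[OF K] in auto)
    then show False using p(1) by simp
  qed
  ultimately show thesis using that by blast
qed

lemma purely_transcendental_step:
  assumes K: "is_subfield K" and L: "purely_transcendental K n L"
    and x: "\<not> algebraic_over L x" and M: "M = is_subfield hull (L \<union> {x})"
  shows "purely_transcendental K (Suc n) M"
proof -
  obtain X where X: "finite X" "card X = n" "algebraically_independent K X" "L = is_subfield hull (K \<union> X)"
    using L unfolding purely_transcendental_def by blast
  have "x \<notin> X"
  proof
    assume "x \<in> X"
    then have xL: "x \<in> L" unfolding X(4) by (simp add: hull_inc)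
    have L: "is_subring L" unfolding X(4) by (rule subfield_subring[OF is_subfield_hull])
    have "\<forall>i. coeff [:- x, 1:] i \<in> L"
      using subring_0[OF L] subring_1[OF L] subring_uminus[OF L xL] by (auto simp: coeff_pCons split: nat.splits)
    moreover have "poly [:- x, 1:] x = 0" "[:- x, 1:] \<noteq> 0" by auto
    ultimately show False using x unfolding algebraic_over_def by blast
  qed
  moreover have "M = is_subfield hull (K \<union> insert x X)"
    unfolding M X(4) using hull_Un_left[of is_subfield "K \<union> X" "{x}"] by simp
  ultimately show ?thesis
    unfolding purely_transcendental_def using X algebraically_independent_insert[OF K X(3)] x
    by (intro exI[of _ "insert x X"]) auto
qed

theorem theorem4p8:
  fixes \<phi> :: "'k::field_char_0 \<Rightarrow> 'b::idom"
    and A :: "nat \<Rightarrow> 'b set"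
    and n :: nat
  assumes "affine_domain \<phi>"
    and "normal_domain (UNIV :: 'b set)"
    and "n \<ge> 1"
    and "\<forall>i\<in>{0..n}. A i \<in> A_sets"
    and "\<forall>i\<in>{1..n}. A (i - 1) \<subset> A i"
    and "\<forall>i\<in>{1..n}. trdeg_eq (A i) (A (i - 1)) 1"
    and "frac_field (A n) \<in> K_sets \<or> frac_field (A (n - 1)) \<in> K_sets"
  shows "(\<forall>i\<in>{1..n}. frac_field (A (i - 1)) \<in> K_sets \<and> A (i - 1) \<in> A1_star (A i)) \<and>
         purely_transcendental (frac_field (A 0)) n (frac_field (A n))"
proof -
  have char: "CHAR('b) = 0" by (rule affine_domain_char_0[OF assms(1)])
  note normal = assms(2)
  have A: "A i \<in> A_sets" if "i \<le> n" for i using assms(4) that by simp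
  have sub: "A i \<subset> A (Suc i)" and trdeg: "trdeg_eq (A (Suc i)) (A i) 1" if "i < n" for i
    using assms(5,6)[rule_format, of "Suc i"] that by simp_all
  have subring: "is_subring (A i)" if "i \<le> n" for i
    using A[OF that] is_subring_A_of by (auto simp: A_sets_def)
  have descend: "frac_field (A i) \<in> K_sets" if "frac_field (A (Suc i)) \<in> K_sets" "i < n" for i
    using frac_in_K_sets_descends[OF char normal A A sub trdeg] that by simp
  have top: "frac_field (A (n - 1)) \<in> K_sets"
    using assms(7)
  proof
    assume "frac_field (A n) \<in> K_sets"
    then show ?thesis using descend[of "n - 1"] assms(3) by simp
  qed
  have K: "frac_field (A i) \<in> K_sets" if "i \<le> n - 1" for i
    using that
  proof (induction i rule: inc_induct)
    case base
    show ?case by (fact top)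
  next
    case (step i)
    then show ?case using descend[of i] by simp
  qed
  have star: "A i \<in> A1_star (A (Suc i))" if "i < n" for i
    using A1_star_if_frac_in_K_sets[OF char normal A A sub trdeg K] that by simp
  have pure: "purely_transcendental (frac_field (A 0)) i (frac_field (A i))" if "i \<le> n" for i
    using that
  proof (induction i)
    case 0
    have "is_subfield hull frac_field (A 0) = frac_field (A 0)"
      using subring[of 0] by (intro hull_same is_subfield_frac_field) simp
    then show ?case
      unfolding purely_transcendental_def by (intro exI[of _ "{}"]) (simp add: algebraically_independent_empty)
  next
    case (Suc i)
    obtain x where "frac_field (A (Suc i)) = is_subfield hull (frac_field (A i) \<union> {x})"
      "\<not> algebraic_over (frac_field (A i)) x"
      using A1_star_simple_transcendental[OF subring[OF Suc.prems] star] Suc.prems by auto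
    then show ?case
      using purely_transcendental_step[OF is_subfield_frac_field[OF subring[of 0]]] Suc by simp
  qed
  have "frac_field (A (i - 1)) \<in> K_sets \<and> A (i - 1) \<in> A1_star (A i)" if "i \<in> {1..n}" for i
    using K[of "i - 1"] star[of "i - 1"] that by auto
  then show ?thesis using pure[of n] by blast
qed

end
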